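(* Let $\mathcal{X}$ be a hereditary graph class that is small and weakly sparse. Then $\mathcal{X}$ admits an $O(\log n)$-bit adjacency labeling scheme.
   Context: A class of graphs is a set of graphs closed under isomorphism; it is hereditary if closed under taking induced subgraphs. $\mathcal{X}_n$ denotes the set of graphs in $\mathcal{X}$ with vertex set $[n]$. A hereditary class $\mathcal{X}$ is small if there is a constant $c$ with $|\mathcal{X}_n|\le n!\cdot c^n$ for all $n$. It is weakly sparse if for some integer $t$, $K_{t,t}$ is not a subgraph of any graph in the class. For a function $b:\mathbb{N}\to\mathbb{N}$, a $b(n)$-bit adjacency labeling scheme for $\mathcal{X}$ is a pair (encoder, decoder) where for every $G\in\mathcal{X}_n$ the encoder assigns to each vertex a binary string (label) of length $b(n)$ such that the decoder, which depends only on $\mathcal{X}$ and not on $G$, determines whether two vertices are adjacent from their two labels alone. *)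

theory Defs
  imports "Graph_Theory.Graph_Theory" "HOL-Library.Landau_Symbols"
begin

text \<open>
  A finite simple graph is a \<^const>\<open>pair_graph\<close>: a finite, symmetric, loop-free relation on a
  finite vertex set, where an edge is present as both of its orientations.  Vertices are natural
  numbers, so that a graph class is a set; every finite graph is isomorphic to one of this kind.
\<close>

type_synonym ngraph = "nat pair_pre_digraph"

definition graph_class :: "ngraph set \<Rightarrow> bool" where
  "graph_class \<X> \<longleftrightarrow>
     (\<forall>G\<in>\<X>. pair_graph G) \<and>
     (\<forall>G\<in>\<X>. \<forall>H :: ngraph. digraph_iso (with_proj G) (with_proj H) \<longrightarrow> H \<in> \<X>)"

definition hereditary :: "ngraph set \<Rightarrow> bool" where
  "hereditary \<X> \<longleftrightarrow>
     (\<forall>G\<in>\<X>. \<forall>H :: ngraph. induced_subgraph (with_proj H) (with_proj G) \<longrightarrow> H \<in> \<X>)"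

definition labelled_graphs :: "ngraph set \<Rightarrow> nat \<Rightarrow> ngraph set" where
  "labelled_graphs \<X> n = {G \<in> \<X>. pverts G = {1..n}}"

text \<open>
  For a graph class the set counted here is finite, so \<^const>\<open>card\<close> is its true cardinality.
\<close>

definition small :: "ngraph set \<Rightarrow> bool" where
  "small \<X> \<longleftrightarrow> (\<exists>c :: real. \<forall>n. real (card (labelled_graphs \<X> n)) \<le> fact n * c ^ n)"

definition weakly_sparse :: "ngraph set \<Rightarrow> bool" where
  "weakly_sparse \<X> \<longleftrightarrow>
     (\<exists>t. \<forall>G\<in>\<X>. \<not> (\<exists>H :: ngraph. subgraph (with_proj H) (with_proj G) \<and>
                              complete_bipartite_digraph t t (with_proj H)))"

text \<open>
  The decoder sees two labels and nothing else, and is fixed before \<open>n\<close> and \<open>G\<close>; the encoder may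
  depend on the whole graph.  No computability is required of either map.
\<close>

definition adjacency_labeling_scheme ::
  "ngraph set \<Rightarrow> (nat \<Rightarrow> nat) \<Rightarrow> (ngraph \<Rightarrow> nat \<Rightarrow> bool list) \<Rightarrow> (bool list \<Rightarrow> bool list \<Rightarrow> bool) \<Rightarrow> bool"
  where
  "adjacency_labeling_scheme \<X> b enc dec \<longleftrightarrow>
     (\<forall>n. \<forall>G\<in>labelled_graphs \<X> n.
        (\<forall>v\<in>pverts G. length (enc G v) = b n) \<and>
        (\<forall>u\<in>pverts G. \<forall>v\<in>pverts G. u \<noteq> v \<longrightarrow> (dec (enc G u) (enc G v) \<longleftrightarrow> (u, v) \<in> parcs G)))"

end

theory Submission
  imports Defs "HOL-Combinatorics.Multiset_Permutations"
begin

text \<open>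
  It suffices to bound the degeneracy: then every vertex is labelled by its own number and the numbers
  of its boundedly many earlier neighbours in a degeneracy order.

  Suppose some graph of the class has a subgraph of large minimum degree.  As it has no large complete
  bipartite subgraph, the graph joining vertices with a common neighbour of low degree is much denser
  than the graph itself, and random sampling leaves an independent set \<open>B\<close> and many further vertices
  with exactly two neighbours in \<open>B\<close>, different ones for different vertices.  Up to edges between the
  further vertices, which cost only a factor exponential in the number of vertices, this is an induced
  subdivision of a dense graph \<open>\<Gamma>\<close>, so arbitrary subgraphs of \<open>\<Gamma>\<close> may be chosen.

  If \<open>\<Gamma>\<close> is connected and its maximum degree is polynomial in its density, its subgraphs containing a
  fixed spanning tree have too many labelled subdivisions for a small class, since few numberings of
  them coincide.  Otherwise a few hubs meet most edges, and joining pairs of hubs through the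
  remaining vertices yields a much denser graph on the hubs (or a large complete graph), with
  paths about twice as long.  The density grows fast enough to compensate for the length of the paths.
\<close>

section \<open>Counting induced subdivisions\<close>

text \<open>Choosing \<open>7 * b\<close> edges from \<open>7 * k * b\<close>, for \<open>b\<close>
  branch vertices, gives at least \<open>k ^ 7\<close> choices per branch vertex. Smallness, with
  the factorials cancelled and the types of the vertices included, allows
  \<open>(c * (l + 1)) ^ (9 * l)\<close>. The loss by coinciding numberings is kept to about the
  maximum degree \<open>d\<close> per branch vertex by the common spanning tree. The obstacle is
  that a dense graph may have enormous degrees, and that deleting the vertices responsible may
  delete nearly all edges. A hub is therefore a vertex exceeding the average degree by a factor of
  order \<open>M ^ 4\<close>, where \<open>M\<close> is the density. If the non-hubs keep enough
  edges, then \<open>d\<close> is of order \<open>M ^ 5\<close>, safely below the 7th power. If not,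
  the hubs are so few that one linking path per remaining vertex gives density at least
  \<open>M ^ 4\<close> on them, unless a complete graph appears first, while \<open>l\<close>
  becomes \<open>2 * l + 1\<close>. A threshold whose exponent is quadratic in \<open>l + 1\<close>
  is raised to exactly its 4th power by this change, so an induction on the number of branch
  vertices closes.\<close>

lemma card_le_mult_fibre:
  assumes "finite A" "finite C" "g ` A \<subseteq> C"
    and "\<And>a. a \<in> A \<Longrightarrow> card {a' \<in> A. g a' = g a} \<le> k"
  shows "card A \<le> card C * k"
proof -
  have "A = (\<Union>y\<in>g ` A. {a' \<in> A. g a' = y})" by auto
  then have "card A \<le> (\<Sum>y\<in>g ` A. card {a' \<in> A. g a' = y})"
    using card_UN_le[of "g ` A" "\<lambda>y. {a' \<in> A. g a' = y}"] assms(1) by simp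
  also have "\<dots> \<le> card (g ` A) * k"
    using sum_bounded_above[of "g ` A" "\<lambda>y. card {a' \<in> A. g a' = y}" k] assms(4) by auto
  also have "\<dots> \<le> card C * k"
    using card_mono[OF assms(2,3)] by simp
  finally show ?thesis .
qed

text \<open>\<open>patterns adj V m\<close> is the set of labelled graphs on \<open>{..<m}\<close>, given by their arcs, that embed as
  induced subgraphs of the host graph \<open>adj\<close> on \<open>V\<close>.\<close>

definition pattern :: "('a \<Rightarrow> 'a \<Rightarrow> bool) \<Rightarrow> 'a list \<Rightarrow> (nat \<times> nat) set" where
  "pattern adj xs = {(i, j). i < length xs \<and> j < length xs \<and> adj (xs ! i) (xs ! j)}"

definition patterns :: "('a \<Rightarrow> 'a \<Rightarrow> bool) \<Rightarrow> 'a set \<Rightarrow> nat \<Rightarrow> (nat \<times> nat) set set" where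
  "patterns adj V m = pattern adj ` {xs. set xs \<subseteq> V \<and> distinct xs \<and> length xs = m}"

lemma pattern_iff:
  "(i, j) \<in> pattern adj xs \<longleftrightarrow> i < length xs \<and> j < length xs \<and> adj (xs ! i) (xs ! j)"
  by (simp add: pattern_def)

lemma finite_patterns: "finite V \<Longrightarrow> finite (patterns adj V m)"
proof -
  assume "finite V"
  have "{xs. set xs \<subseteq> V \<and> distinct xs \<and> length xs = m} \<subseteq> {xs. set xs \<subseteq> V \<and> length xs = m}"
    by auto
  then show ?thesis unfolding patterns_def
    using finite_lists_length_eq[OF \<open>finite V\<close>, of m] finite_subset by blast
qed

section \<open>Spanning trees and their homomorphisms\<close>

definition crossing :: "'a set set \<Rightarrow> 'a set \<Rightarrow> bool" where
  "crossing E B \<longleftrightarrow> (\<forall>Z. Z \<subset> B \<longrightarrow> Z \<noteq> {} \<longrightarrow> (\<exists>x\<in>Z. \<exists>y\<in>B - Z. {x, y} \<in> E))"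

text \<open>Recording how a tree grows makes the homomorphism count an induction in which each step
  attaches one leaf.\<close>

inductive tree_in :: "'a set set \<Rightarrow> 'a set \<Rightarrow> 'a set set \<Rightarrow> bool" for E where
  root: "tree_in E {x} {}"
| grow: "tree_in E Z T \<Longrightarrow> x \<in> Z \<Longrightarrow> y \<notin> Z \<Longrightarrow> {x, y} \<in> E \<Longrightarrow> tree_in E (insert y Z) (insert {x, y} T)"

lemma tree_in_finite: "tree_in E Z T \<Longrightarrow> finite Z \<and> finite T \<and> T \<subseteq> E \<and> card T < card Z \<and> \<Union>T \<subseteq> Z"
  by (induction rule: tree_in.induct) (auto simp: card_insert_if)

text \<open>\<open>crossing\<close> states connectedness by cuts, the form that minimality of a
  dense vertex set yields; an edge across the cut enlarges a partial tree by one vertex.\<close>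

lemma tree_in_exists:
  assumes "finite B" "B \<noteq> {}" "crossing E B"
  shows "\<exists>T. tree_in E B T"
proof -
  obtain b where "b \<in> B" using assms(2) by auto
  have "\<exists>Z T. Z \<subseteq> B \<and> card Z = Suc k \<and> tree_in E Z T" if "Suc k \<le> card B" for k
    using that
  proof (induction k)
    case 0
    show ?case using \<open>b \<in> B\<close> by (intro exI[of _ "{b}"] exI[of _ "{}"]) (auto intro: root)
  next
    case (Suc k)
    then obtain Z T where Z: "Z \<subseteq> B" "card Z = Suc k" "tree_in E Z T" by auto
    then have "Z \<subset> B" "Z \<noteq> {}" using Suc.prems by auto
    then obtain x y where "x \<in> Z" "y \<in> B - Z" "{x, y} \<in> E"
      using assms(3) unfolding crossing_def by blast
    moreover have "finite Z" using Z(1) assms(1) finite_subset by blast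
    ultimately show ?case using Z
      by (intro exI[of _ "insert y Z"] exI[of _ "insert {x, y} T"]) (auto intro: grow)
  qed
  from this[of "card B - 1"] have "\<exists>Z T. Z \<subseteq> B \<and> card Z = card B \<and> tree_in E Z T"
    using assms by (auto simp: card_gt_0_iff Suc_le_eq)
  then show ?thesis using card_subset_eq[OF assms(1)] by blast
qed

definition homs :: "'a set \<Rightarrow> 'a set set \<Rightarrow> 'a set \<Rightarrow> 'a set set \<Rightarrow> ('a \<Rightarrow> 'a) set" where
  "homs B E Z T = {\<phi> \<in> Z \<rightarrow>\<^sub>E B. \<forall>x y. {x, y} \<in> T \<longrightarrow> {\<phi> x, \<phi> y} \<in> E}"

text \<open>The first vertex has at most \<open>card B\<close> images; each later one is joined to a
  vertex already placed and so has at most \<open>d\<close>.\<close>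

lemma card_homs_tree:
  assumes "tree_in E Z T" "finite B" "\<And>x. x \<in> B \<Longrightarrow> card {y \<in> B. {x, y} \<in> E} \<le> d" "1 \<le> d"
  shows "card (homs B E Z T) \<le> card B * d ^ card Z \<and> finite (homs B E Z T)"
  using assms(1)
proof (induction rule: tree_in.induct)
  case (root x)
  have "homs B E {x} {} = {x} \<rightarrow>\<^sub>E B" by (auto simp: homs_def)
  then show ?case using assms(2,4) by (simp add: card_PiE finite_PiE)
next
  case (grow Z T x y)
  have fZ: "finite Z" and TZ: "\<Union>T \<subseteq> Z" using tree_in_finite[OF grow.hyps(1)] by auto
  let ?g = "\<lambda>\<phi>. (restrict \<phi> Z, \<phi> y)"
  let ?S = "Sigma (homs B E Z T) (\<lambda>\<psi>. {z \<in> B. {\<psi> x, z} \<in> E})"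
  have inj: "inj_on ?g (homs B E (insert y Z) (insert {x, y} T))"
  proof (rule inj_onI)
    fix \<phi> \<psi> assume *: "\<phi> \<in> homs B E (insert y Z) (insert {x, y} T)"
      "\<psi> \<in> homs B E (insert y Z) (insert {x, y} T)" "?g \<phi> = ?g \<psi>"
    then have "\<phi> v = \<psi> v" if "v \<in> insert y Z" for v
      using that by (metis insertE prod.inject restrict_apply')
    then show "\<phi> = \<psi>" using * unfolding homs_def by (auto intro: PiE_ext)
  qed
  have sub: "?g ` homs B E (insert y Z) (insert {x, y} T) \<subseteq> ?S"
  proof clarify
    fix \<phi> assume h: "\<phi> \<in> homs B E (insert y Z) (insert {x, y} T)"
    have "restrict \<phi> Z \<in> homs B E Z T"
    proof -
      have "{restrict \<phi> Z u, restrict \<phi> Z v} \<in> E" if "{u, v} \<in> T" for u v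
      proof -
        have "u \<in> Z" "v \<in> Z" using that TZ by auto
        then show ?thesis using h that unfolding homs_def by auto
      qed
      then show ?thesis using h unfolding homs_def by (auto simp: PiE_iff)
    qed
    moreover have "\<phi> y \<in> B" "{\<phi> x, \<phi> y} \<in> E" using h unfolding homs_def by auto
    ultimately show "restrict \<phi> Z \<in> homs B E Z T \<and> \<phi> y \<in> {z \<in> B. {restrict \<phi> Z x, z} \<in> E}"
      using grow.hyps(2) by auto
  qed
  have finS: "finite ?S" using grow.IH assms(2) by (intro finite_SigmaI) auto
  have "card ?S = (\<Sum>\<psi>\<in>homs B E Z T. card {z \<in> B. {\<psi> x, z} \<in> E})"
    using grow.IH assms(2) by simp
  also have "\<dots> \<le> card (homs B E Z T) * d"
  proof -
    have "card {z \<in> B. {\<psi> x, z} \<in> E} \<le> d" if "\<psi> \<in> homs B E Z T" for \<psi>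
      using that grow.hyps(2) assms(3) unfolding homs_def by auto
    then show ?thesis using sum_bounded_above[of "homs B E Z T" _ d] by fastforce
  qed
  also have "\<dots> \<le> (card B * d ^ card Z) * d" using grow.IH by simp
  finally have "card ?S \<le> card B * d ^ card (insert y Z)" using fZ grow.hyps(3) by (simp add: mult_ac)
  moreover have "card (homs B E (insert y Z) (insert {x, y} T)) \<le> card ?S"
    using card_inj_on_le[OF inj sub finS] .
  moreover have "finite (homs B E (insert y Z) (insert {x, y} T))"
    using inj sub finS by (meson finite_imageD finite_subset)
  ultimately show ?case by linarith
qed

text \<open>A graph with vertex set \<open>B\<close> and edge set \<open>E\<close>, each edge \<open>e\<close> of which is replaced by a path with
  interior \<open>P e\<close>; the result is induced in the host graph.\<close>

locale induced_subdivision =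
  fixes adj :: "'a \<Rightarrow> 'a \<Rightarrow> bool" and V :: "'a set" and l :: nat
    and B :: "'a set" and E :: "'a set set" and P :: "'a set \<Rightarrow> 'a list"
  assumes fin_V: "finite V"
    and adj_sym: "adj u v \<Longrightarrow> adj v u"
    and B_sub: "B \<subseteq> V"
    and l_pos: "1 \<le> l"
    and E_sub: "e \<in> E \<Longrightarrow> e \<subseteq> B \<and> card e = 2"
    and B_indep: "x \<in> B \<Longrightarrow> y \<in> B \<Longrightarrow> \<not> adj x y"
    and P_len: "e \<in> E \<Longrightarrow> length (P e) = l"
    and P_dist: "e \<in> E \<Longrightarrow> distinct (P e)"
    and P_sub: "e \<in> E \<Longrightarrow> set (P e) \<subseteq> V - B"
    and P_disj: "e \<in> E \<Longrightarrow> f \<in> E \<Longrightarrow> e \<noteq> f \<Longrightarrow> set (P e) \<inter> set (P f) = {}"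
    and P_nonadj: "e \<in> E \<Longrightarrow> f \<in> E \<Longrightarrow> e \<noteq> f \<Longrightarrow> u \<in> set (P e) \<Longrightarrow> v \<in> set (P f) \<Longrightarrow> \<not> adj u v"
    and P_adj_B: "e \<in> E \<Longrightarrow> v \<in> set (P e) \<Longrightarrow> x \<in> B \<Longrightarrow> adj v x \<Longrightarrow> x \<in> e"
    and P_path: "e \<in> E \<Longrightarrow> \<exists>x y. e = {x, y} \<and> successively adj (x # P e @ [y])"
begin

lemma fin_B: "finite B" using fin_V B_sub finite_subset by blast

lemma fin_E: "finite E"
  by (rule finite_subset[of _ "Pow B"]) (use E_sub fin_B in auto)

text \<open>The type of a vertex: \<open>0\<close> on \<open>B\<close>, and the successor of its index within its path elsewhere.\<close>

definition pos :: "'a \<Rightarrow> nat" where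
  "pos v = (if v \<in> B then 0 else Suc (SOME i. i < l \<and> (\<exists>e\<in>E. P e ! i = v)))"

lemma pos_B: "x \<in> B \<Longrightarrow> pos x = 0" by (simp add: pos_def)

lemma P_nth_notin_B: "e \<in> E \<Longrightarrow> i < l \<Longrightarrow> P e ! i \<notin> B"
  using P_sub P_len nth_mem by fastforce

lemma P_nth_inj: "e \<in> E \<Longrightarrow> f \<in> E \<Longrightarrow> i < l \<Longrightarrow> j < l \<Longrightarrow> P e ! i = P f ! j \<Longrightarrow> e = f \<and> i = j"
  using P_disj[of e f] P_len P_dist nth_mem nth_eq_iff_index_eq
  by (metis disjoint_iff)

lemma pos_P: "e \<in> E \<Longrightarrow> i < l \<Longrightarrow> pos (P e ! i) = Suc i"
proof -
  assume e: "e \<in> E" "i < l"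
  have "(SOME j. j < l \<and> (\<exists>f\<in>E. P f ! j = P e ! i)) = i"
    by (rule some_equality) (use e P_nth_inj in auto)
  then show ?thesis using P_nth_notin_B[OF e] by (simp add: pos_def)
qed

definition verts_on :: "'a set set \<Rightarrow> 'a set" where
  "verts_on S = B \<union> (\<Union>e\<in>S. set (P e))"

lemma card_verts_on: "S \<subseteq> E \<Longrightarrow> card (verts_on S) = card B + card S * l"
proof -
  assume S: "S \<subseteq> E"
  have fS: "finite S" using S fin_E finite_subset by blast
  have "card (\<Union>e\<in>S. set (P e)) = (\<Sum>e\<in>S. card (set (P e)))"
    by (rule card_UN_disjoint) (use S P_disj fS in auto)
  also have "\<dots> = (\<Sum>e\<in>S. l)"
    by (rule sum.cong) (use S P_len P_dist in \<open>auto simp: subset_iff distinct_card\<close>)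
  finally have "card (\<Union>e\<in>S. set (P e)) = card S * l" by simp
  moreover have "B \<inter> (\<Union>e\<in>S. set (P e)) = {}" using S P_sub by blast
  ultimately show ?thesis unfolding verts_on_def
    using card_Un_disjoint[of B "\<Union>e\<in>S. set (P e)"] fin_B fS by simp
qed

lemma verts_on_V: "S \<subseteq> E \<Longrightarrow> verts_on S \<subseteq> V"
  using P_sub B_sub by (fastforce simp: verts_on_def)

lemma verts_on_cases:
  assumes "v \<in> verts_on S" "S \<subseteq> E"
  obtains "v \<in> B" | e i where "e \<in> S" "i < l" "v = P e ! i"
  using assms P_len unfolding verts_on_def by (auto simp: in_set_conv_nth subset_iff)

lemma pos_le: "S \<subseteq> E \<Longrightarrow> v \<in> verts_on S \<Longrightarrow> pos v \<le> l"
  by (erule verts_on_cases, assumption) (auto simp: pos_B pos_P subset_iff)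

text \<open>A type-preserving isomorphism between two subdivided subgraphs is determined by its
  restriction to the branch vertices, since the pieces are the components of what remains.\<close>

lemma iso_piece:
  assumes S: "S \<subseteq> E" "S' \<subseteq> E"
    and img: "\<And>v. v \<in> verts_on S \<Longrightarrow> \<phi> v \<in> verts_on S'"
    and inj: "inj_on \<phi> (verts_on S)"
    and adj: "\<And>u v. u \<in> verts_on S \<Longrightarrow> v \<in> verts_on S \<Longrightarrow> adj u v \<Longrightarrow> adj (\<phi> u) (\<phi> v)"
    and pos: "\<And>v. v \<in> verts_on S \<Longrightarrow> pos (\<phi> v) = pos v"
    and e: "e \<in> S"
  shows "\<phi> ` e \<in> S' \<and> (\<forall>i<l. \<phi> (P e ! i) = P (\<phi> ` e) ! i)"
proof -
  have eE: "e \<in> E" using S e by auto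
  have Pv: "P e ! i \<in> verts_on S" if "i < l" for i
    using that e P_len[OF eE] unfolding verts_on_def by (auto intro!: bexI[of _ e])
  have im: "\<exists>f\<in>S'. \<phi> (P e ! i) = P f ! i" if i: "i < l" for i
  proof -
    have p: "pos (\<phi> (P e ! i)) = Suc i" using pos[OF Pv[OF i]] pos_P[OF eE i] by simp
    show ?thesis
      using img[OF Pv[OF i]] S(2)
    proof (cases rule: verts_on_cases)
      case 1
      then show ?thesis using p pos_B by simp
    next
      case (2 f j)
      then show ?thesis using p pos_P[of f j] S(2) by auto
    qed
  qed
  obtain x y where xy: "e = {x, y}" and path: "successively adj (x # P e @ [y])"
    using P_path[OF eE] by auto
  have xB: "x \<in> B" "y \<in> B" "x \<noteq> y" using E_sub[OF eE] xy by auto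
  have xv: "x \<in> verts_on S" "y \<in> verts_on S" using xB by (auto simp: verts_on_def)
  have Pne: "P e \<noteq> []" using P_len[OF eE] l_pos by auto
  have sP: "successively adj (P e)" and xa: "adj x (P e ! 0)" and ya: "adj (P e ! (l - 1)) y"
    using path Pne P_len[OF eE] by (auto simp: successively_append_iff successively_Cons hd_conv_nth last_conv_nth nth_append)
  obtain f where f: "f \<in> S'" "\<phi> (P e ! 0) = P f ! 0" using im[of 0] l_pos by auto
  \<comment> \<open>Consecutive interior vertices are adjacent, and different pieces have no edges
    between them, so the image cannot leave the piece \<open>f\<close> of its first vertex.\<close>
  have all: "\<phi> (P e ! i) = P f ! i" if "i < l" for i
    using that
  proof (induction i)
    case 0
    then show ?case using f by simp
  next
    case (Suc i)
    obtain g where g: "g \<in> S'" "\<phi> (P e ! Suc i) = P g ! Suc i" using im[OF Suc.prems] by auto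
    have "adj (P e ! i) (P e ! Suc i)"
      using sP Suc.prems P_len[OF eE] successively_conv_nth by metis
    then have "adj (P f ! i) (P g ! Suc i)"
      using adj[OF Pv Pv] Suc g by (metis Suc_lessD)
    moreover have "P f ! i \<in> set (P f)" "P g ! Suc i \<in> set (P g)"
      using P_len f g S Suc.prems by (auto simp: subset_iff)
    ultimately have "f = g" using P_nonadj f g S by blast
    then show ?case using g by simp
  qed
  have ph: "\<phi> x \<in> B" "\<phi> y \<in> B"
  proof -
    have "\<phi> z \<in> B" if "z \<in> B" for z
    proof -
      have zv: "z \<in> verts_on S" using that by (auto simp: verts_on_def)
      have p: "pos (\<phi> z) = 0" using pos[OF zv] pos_B[OF that] by simp
      show ?thesis using img[OF zv] S(2)
        by (cases rule: verts_on_cases) (use p pos_P S(2) in auto)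
    qed
    then show "\<phi> x \<in> B" "\<phi> y \<in> B" using xB by auto
  qed
  have fE: "f \<in> E" using f S by auto
  have mem: "P f ! i \<in> set (P f)" if "i < l" for i using P_len[OF fE] that by auto
  \<comment> \<open>Both ends of \<open>e\<close> have neighbours in \<open>P e\<close>, so their
    images have neighbours in \<open>P f\<close> and must be the two ends of
    \<open>f\<close>.\<close>
  have "\<phi> x \<in> f"
    using P_adj_B[OF fE mem[of 0] ph(1)] adj[OF xv(1) Pv[of 0] xa] all[of 0] l_pos adj_sym by auto
  moreover have "\<phi> y \<in> f"
    using P_adj_B[OF fE mem[of "l - 1"] ph(2)] adj[OF Pv[of "l - 1"] xv(2) ya] all[of "l - 1"] l_pos by auto
  moreover have "\<phi> x \<noteq> \<phi> y" using inj xv xB(3) by (auto dest: inj_onD)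
  ultimately have "f = {\<phi> x, \<phi> y}"
    using E_sub[OF fE] by (metis card_2_iff doubleton_eq_iff insertE singletonD)
  then have "\<phi> ` e = f" using xy by auto
  then show ?thesis using f all by auto
qed

text \<open>Double counting of pairs of a choice \<open>R\<close> of \<open>r\<close> edges outside the tree \<open>T\<close> and a numbering of the
  subdivided subgraph.  Given the resulting labelled graph and the types of its vertices, a pair is
  determined by a homomorphism of the tree.\<close>

lemma count_subdivisions:
  assumes tree: "tree_in E B T"
    and deg: "\<And>x. x \<in> B \<Longrightarrow> card {y \<in> B. {x, y} \<in> E} \<le> d" "1 \<le> d"
    and small: "\<And>m. card (patterns adj V m) \<le> fact m * c ^ m"
  shows "(card (E - T) choose r) \<le> (c * (l + 1)) ^ (card B + (card T + r) * l) * (card B * d ^ card B)"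
proof -
  define m where "m = card B + (card T + r) * l"
  define Rs where "Rs = {R. R \<subseteq> E - T \<and> card R = r}"
  define X where "X = Sigma Rs (\<lambda>R. permutations_of_set (verts_on (T \<union> R)))"
  \<comment> \<open>The labelled graph alone does not show which vertices are branch vertices.
    Adding all types costs a factor of at most \<open>(l + 1) ^ m\<close> and makes the isomorphisms
    type-preserving.\<close>
  define g where "g = (\<lambda>(R :: 'a set set, xs). (pattern adj xs, map pos xs))"
  have TE: "T \<subseteq> E" and fT: "finite T" using tree_in_finite[OF tree] by auto
  have fRs: "finite Rs" unfolding Rs_def using fin_E by auto
  have RE: "T \<union> R \<subseteq> E" if "R \<in> Rs" for R using that TE Rs_def by auto
  have cU: "card (verts_on (T \<union> R)) = m" if "R \<in> Rs" for R
  proof -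
    have "finite R" using that fin_E unfolding Rs_def by (metis (mono_tags) finite_Diff finite_subset mem_Collect_eq)
    then have "card (T \<union> R) = card T + r" using that fT card_Un_disjoint[of T R] unfolding Rs_def by auto
    then show ?thesis using card_verts_on[OF RE[OF that]] unfolding m_def by simp
  qed
  have fU: "finite (verts_on (T \<union> R))" if "R \<in> Rs" for R
    using verts_on_V[OF RE[OF that]] fin_V finite_subset by blast
  have Xm: "set xs = verts_on (T \<union> R) \<and> distinct xs \<and> length xs = m \<and> R \<in> Rs" if "(R, xs) \<in> X" for R xs
    using that cU unfolding X_def permutations_of_set_def by (auto simp: distinct_card[symmetric])
  have fX: "finite X" unfolding X_def using fRs by auto
  have "card X = (\<Sum>R\<in>Rs. fact m)" unfolding X_def using fRs fU cU by simp
  also have "\<dots> = (card (E - T) choose r) * fact m"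
    unfolding Rs_def using n_subsets[of "E - T" r] fin_E by simp
  finally have cX: "card X = (card (E - T) choose r) * fact m" .
  define C where "C = patterns adj V m \<times> {ts. set ts \<subseteq> {..l} \<and> length ts = m}"
  have fC: "finite C" unfolding C_def using finite_patterns[OF fin_V] finite_lists_length_eq[of "{..l}"] by auto
  have cC: "card C \<le> fact m * (c * (l + 1)) ^ m"
    unfolding C_def using small[of m] card_lists_length_eq[of "{..l}" m]
    by (simp add: card_cartesian_product power_mult_distrib mult_le_mono1 flip: mult.assoc del: mult_Suc_right)
  have gX: "g ` X \<subseteq> C"
  proof (rule image_subsetI)
    fix a assume "a \<in> X"
    then obtain R xs where a: "a = (R, xs)" and Rx: "(R, xs) \<in> X" by (cases a) auto
    note q = Xm[OF Rx]
    then show "g a \<in> C"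
      using a verts_on_V[OF RE, of R] pos_le[OF RE, of R]
      unfolding g_def C_def patterns_def by auto
  qed
  have fib: "card {a' \<in> X. g a' = g a} \<le> card B * d ^ card B" if a: "a \<in> X" for a
  proof -
    obtain R0 xs0 where a0: "a = (R0, xs0)" by (cases a)
    note q0 = Xm[OF a[unfolded a0]]
    have TR0: "T \<union> R0 \<subseteq> E" using RE q0 by blast
    \<comment> \<open>\<open>idx\<close> inverts the fixed numbering \<open>xs0\<close>, so
      \<open>\<lambda>v. xs ! idx v\<close> is the isomorphism from the fixed subgraph to the one
      numbered by \<open>xs\<close>.\<close>
    define idx where "idx = (\<lambda>v. SOME i. i < m \<and> xs0 ! i = v)"
    have idx: "idx v < m \<and> xs0 ! idx v = v" if "v \<in> verts_on (T \<union> R0)" for v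
      unfolding idx_def by (rule someI_ex) (use that q0 in \<open>auto simp: in_set_conv_nth\<close>)
    have idx_nth: "idx (xs0 ! i) = i" if "i < m" for i
    proof -
      have "xs0 ! i \<in> verts_on (T \<union> R0)" using that q0 nth_mem by metis
      from idx[OF this] show ?thesis using that q0 nth_eq_iff_index_eq by metis
    qed
    have nthv: "xs0 ! i \<in> verts_on (T \<union> R0)" if "i < m" for i using that q0 nth_mem by metis
    have Bv: "x \<in> verts_on S" if "x \<in> B" for x S using that by (simp add: verts_on_def)
    have key: "(\<forall>v\<in>B. xs ! idx v \<in> B) \<and> (\<forall>e\<in>T \<union> R0. (\<lambda>v. xs ! idx v) ` e \<in> E \<and>
        (\<forall>i<l. xs ! idx (P e ! i) = P ((\<lambda>v. xs ! idx v) ` e) ! i))"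
      if Rx: "(R, xs) \<in> X" "g (R, xs) = g a" for R xs
    proof -
      note q = Xm[OF Rx(1)]
      have pat: "pattern adj xs = pattern adj xs0" and ps: "map pos xs = map pos xs0"
        using Rx(2) a0 unfolding g_def by auto
      have ad: "adj (xs ! i) (xs ! j) \<longleftrightarrow> adj (xs0 ! i) (xs0 ! j)" if "i < m" "j < m" for i j
        using pat pattern_iff[of i j adj xs] pattern_iff[of i j adj xs0] that q q0 by simp
      have po: "pos (xs ! i) = pos (xs0 ! i)" if "i < m" for i
        using arg_cong[OF ps, of "\<lambda>z. z ! i"] that q q0 by simp
      have TR: "T \<union> R \<subseteq> E" using RE q by blast
      let ?\<phi> = "\<lambda>v. xs ! idx v"
      have 1: "?\<phi> v \<in> verts_on (T \<union> R)" if "v \<in> verts_on (T \<union> R0)" for v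
        using idx[OF that] q nth_mem by metis
      have 2: "inj_on ?\<phi> (verts_on (T \<union> R0))"
      proof (rule inj_onI)
        fix u v assume uv: "u \<in> verts_on (T \<union> R0)" "v \<in> verts_on (T \<union> R0)" "?\<phi> u = ?\<phi> v"
        then have "idx u = idx v" using idx q nth_eq_iff_index_eq by metis
        then show "u = v" using idx uv by metis
      qed
      have 3: "adj (?\<phi> u) (?\<phi> v)" if "u \<in> verts_on (T \<union> R0)" "v \<in> verts_on (T \<union> R0)" "adj u v" for u v
        using ad[of "idx u" "idx v"] idx that by simp
      have 4: "pos (?\<phi> v) = pos v" if "v \<in> verts_on (T \<union> R0)" for v
        using po[of "idx v"] idx that by simp
      have "?\<phi> v \<in> B" if "v \<in> B" for v
        using 1[OF Bv[OF that]] TR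
        by (cases rule: verts_on_cases) (use 4[OF Bv[OF that]] pos_B[OF that] pos_P TR in \<open>auto simp: subset_iff\<close>)
      moreover have "?\<phi> ` e \<in> E \<and> (\<forall>i<l. ?\<phi> (P e ! i) = P (?\<phi> ` e) ! i)" if "e \<in> T \<union> R0" for e
        using iso_piece[OF TR0 TR 1 2 3 4 that] TR by auto
      ultimately show ?thesis by blast
    qed
    \<comment> \<open>Only branch vertices are recorded: \<open>iso_piece\<close> recovers the
      interiors, and since \<open>T\<close> lies in the fixed subgraph, the recorded map is a
      homomorphism of \<open>T\<close>.\<close>
    define h where "h = (\<lambda>(R :: 'a set set, xs :: 'a list). restrict (\<lambda>v. xs ! idx v) B)"
    have "h ` {a' \<in> X. g a' = g a} \<subseteq> homs B E B T"
    proof clarify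
      fix R xs assume Rx: "(R, xs) \<in> X" "g (R, xs) = g a"
      note k = key[OF Rx]
      have "{xs ! idx x, xs ! idx y} \<in> E \<and> x \<in> B \<and> y \<in> B" if "{x, y} \<in> T" for x y
      proof -
        have "(\<lambda>v. xs ! idx v) ` {x, y} \<in> E" using k that by blast
        then show ?thesis using that TE E_sub by force
      qed
      then show "h (R, xs) \<in> homs B E B T" using k unfolding homs_def h_def by auto
    qed
    moreover have "inj_on h {a' \<in> X. g a' = g a}"
    proof (rule inj_onI, clarify)
      fix R xs R' xs' assume Rx: "(R, xs) \<in> X" "g (R, xs) = g a" and Rx': "(R', xs') \<in> X" "g (R', xs') = g a"
        and eq: "h (R, xs) = h (R', xs')"
      note k = key[OF Rx] and k' = key[OF Rx'] and q = Xm[OF Rx(1)] and q' = Xm[OF Rx'(1)]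
      have eqB: "xs ! idx v = xs' ! idx v" if "v \<in> B" for v
        using fun_cong[OF eq[unfolded h_def], of v] that by simp
      have xs: "xs ! i = xs' ! i" if i: "i < m" for i
        using nthv[OF i] TR0
      proof (cases rule: verts_on_cases)
        case 1
        then show ?thesis using eqB[OF 1] idx_nth[OF i] by simp
      next
        case (2 e j)
        have eE: "e \<in> E" using 2 RE[of R0] q0 by auto
        have "(\<lambda>v. xs ! idx v) ` e = (\<lambda>v. xs' ! idx v) ` e"
          by (rule image_cong) (use eqB E_sub[OF eE] in auto)
        then have "xs ! idx (P e ! j) = xs' ! idx (P e ! j)" using k k' 2 by (metis (no_types, lifting))
        then show ?thesis using idx_nth[OF i] 2 by simp
      qed
      have xx: "xs = xs'" using xs q q' by (auto intro: nth_equalityI)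
      \<comment> \<open>The vertex set reveals the chosen edges: an edge is present exactly if the
        first interior vertex of its path is, which exists as \<open>1 \<le> l\<close>.\<close>
      have mem: "f \<in> T \<union> R1 \<longleftrightarrow> f \<in> E \<and> P f ! 0 \<in> verts_on (T \<union> R1)" if "R1 \<in> Rs" for f R1
      proof
        assume f: "f \<in> T \<union> R1"
        then have fE: "f \<in> E" using RE[OF that] by auto
        then have "P f ! 0 \<in> set (P f)" using P_len l_pos by simp
        then show "f \<in> E \<and> P f ! 0 \<in> verts_on (T \<union> R1)"
          using f fE unfolding verts_on_def by blast
      next
        assume f: "f \<in> E \<and> P f ! 0 \<in> verts_on (T \<union> R1)"
        then have "P f ! 0 \<in> verts_on (T \<union> R1)" by simp
        then show "f \<in> T \<union> R1" using RE[OF that]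
        proof (cases rule: verts_on_cases)
          case 1
          then show ?thesis using P_nth_notin_B[of f 0] f l_pos by auto
        next
          case (2 e j)
          then show ?thesis using P_nth_inj[of f e 0 j] f l_pos RE[OF that] by auto
        qed
      qed
      have "T \<union> R = T \<union> R'" using mem[of R] mem[of R'] q q' xx by auto
      then have "R = R'" using q q' unfolding Rs_def by auto
      then show "R = R' \<and> xs = xs'" using xx by simp
    qed
    ultimately have "card {a' \<in> X. g a' = g a} \<le> card (homs B E B T)"
      using card_homs_tree[OF tree fin_B deg] card_inj_on_le by blast
    then show ?thesis using card_homs_tree[OF tree fin_B deg] by linarith
  qed
  have "(card (E - T) choose r) * fact m \<le> card C * (card B * d ^ card B)"
    using card_le_mult_fibre[OF fX fC gX fib] cX by simp
  also have "\<dots> \<le> (fact m * (c * (l + 1)) ^ m) * (card B * d ^ card B)"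
    using cC by (intro mult_right_mono) auto
  \<comment> \<open>The \<open>fact m\<close> numberings on the left cancel against the factorial
    granted by smallness.\<close>
  finally have "fact m * (card (E - T) choose r) \<le> fact m * ((c * (l + 1)) ^ m * (card B * d ^ card B))"
    by (simp add: mult_ac)
  then show ?thesis unfolding m_def by simp
qed

end

section \<open>Dense graphs with long subdivided edges\<close>

lemma power_choose_le: "k ^ r \<le> (k * r choose r)" if "0 < r" "0 < k" for k r :: nat
proof -
  have "r \<le> k * r" using that by simp
  from binomial_ge_n_over_k_pow_k[OF this, where 'a = real]
  have "real k ^ r \<le> real (k * r choose r)" using that by simp
  then show ?thesis by (metis of_nat_le_iff of_nat_power)
qed

context induced_subdivision
begin

text \<open>A spanning tree uses fewer than \<open>card B\<close> edges, leaving
  \<open>7 * k * card B\<close> to choose \<open>7 * card B\<close> from; taking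
  \<open>card B\<close>-th roots leaves a bound per branch vertex. The exponent 7 leaves room above
  the degree bound, which will be of order \<open>k ^ 5\<close>.\<close>

lemma count_bound:
  assumes cr: "crossing E B" and ne: "B \<noteq> {}"
    and deg: "\<And>x. x \<in> B \<Longrightarrow> card {y \<in> B. {x, y} \<in> E} \<le> d" "1 \<le> d"
    and small: "\<And>m. card (patterns adj V m) \<le> fact m * c ^ m" and c: "1 \<le> c"
    and dense: "(7 * k + 1) * card B \<le> card E"
  shows "k ^ 7 \<le> 2 * d * (c * (l + 1)) ^ (9 * l)"
proof (cases "k = 0")
  case False
  obtain T where T: "tree_in E B T" using tree_in_exists[OF fin_B ne cr] by auto
  define b where "b = card B"
  have b: "0 < b" using ne fin_B by (simp add: b_def card_gt_0_iff)
  have cT: "card T < b" "T \<subseteq> E" "finite T" using tree_in_finite[OF T] by (auto simp: b_def)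
  have "(7 * k) * b \<le> card (E - T)"
    using cT dense card_Diff_subset[OF cT(3,2)] by (simp add: b_def algebra_simps)
  then have "k ^ (7 * b) \<le> (card (E - T) choose (7 * b))"
    using power_choose_le[of "7 * b" k] b False binomial_right_mono[of "k * (7 * b)" "card (E - T)" "7 * b"]
    by (simp add: mult_ac)
  also have "\<dots> \<le> (c * (l + 1)) ^ (b + (card T + 7 * b) * l) * (b * d ^ b)"
    using count_subdivisions[OF T deg small] by (simp add: b_def)
  \<comment> \<open>The branch vertices, the tree and \<open>7 * b\<close> further pieces have at
    most \<open>9 * l * b\<close> vertices in all; the choice of the image of the root is absorbed
    by \<open>b \<le> 2 ^ b\<close>.\<close>
  also have "\<dots> \<le> (c * (l + 1)) ^ (9 * l * b) * (2 ^ b * d ^ b)"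
  proof (intro mult_mono power_increasing)
    have "(card T + 7 * b) * l \<le> (b + 7 * b) * l" using cT by (intro mult_right_mono) auto
    moreover have "b * 1 \<le> b * l" using l_pos by (intro mult_left_mono) auto
    ultimately have "b + (card T + 7 * b) * l \<le> b * l + (b + 7 * b) * l" by linarith
    then show "b + (card T + 7 * b) * l \<le> 9 * l * b" by (simp add: algebra_simps)
  qed (use c deg(2) in \<open>auto intro: less_imp_le[OF less_exp]\<close>)
  also have "\<dots> = (2 * d * (c * (l + 1)) ^ (9 * l)) ^ b"
    unfolding power_mult[of _ "9 * l" b] power_mult_distrib[of _ _ b] by (simp only: mult_ac)
  finally have "(k ^ 7) ^ b \<le> (2 * d * (c * (l + 1)) ^ (9 * l)) ^ b"
    unfolding power_mult .
  then show ?thesis using b power_mono_iff by blast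
qed simp

section \<open>Restricting subdivisions and concatenating their paths\<close>

lemma sub_subdivision:
  assumes "B' \<subseteq> B" "E' \<subseteq> E" "\<And>e. e \<in> E' \<Longrightarrow> e \<subseteq> B'"
  shows "induced_subdivision adj V l B' E' P"
proof
  fix e assume "e \<in> E'"
  then have "e \<in> E" using assms by auto
  then show "\<exists>x y. e = {x, y} \<and> successively adj (x # P e @ [y])"
    "length (P e) = l" "distinct (P e)" "set (P e) \<subseteq> V - B'" "e \<subseteq> B' \<and> card e = 2"
    using P_path P_len P_dist P_sub[of e] E_sub[of e] assms \<open>e \<in> E'\<close> by auto
next
  fix e v x assume "e \<in> E'" "v \<in> set (P e)" "x \<in> B'" "adj v x"
  then show "x \<in> e" using P_adj_B assms by blast
next
  fix e f u v assume "e \<in> E'" "f \<in> E'" "e \<noteq> f" "u \<in> set (P e)" "v \<in> set (P f)"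
  then show "\<not> adj u v" using P_nonadj[of e f u v] assms by auto
next
  fix e f assume "e \<in> E'" "f \<in> E'" "e \<noteq> f"
  then show "set (P e) \<inter> set (P f) = {}" using P_disj[of e f] assms by auto
next
  fix x y assume "x \<in> B'" "y \<in> B'"
  then show "\<not> adj x y" using B_indep assms by blast
qed (use fin_V adj_sym B_sub l_pos assms in auto)

lemma oriented_path:
  assumes "{x, y} \<in> E"
  shows "\<exists>p. set p = set (P {x, y}) \<and> distinct p \<and> length p = l \<and> successively adj (x # p @ [y])"
proof -
  let ?p = "P {x, y}"
  obtain u v where uv: "{x, y} = {u, v}" "successively adj (u # ?p @ [v])" using P_path[OF assms] by auto
  have "successively adj (rev (u # ?p @ [v]))"
    using uv(2) unfolding successively_rev by (rule successively_mono) (auto intro: adj_sym)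
  then have "successively adj (v # rev ?p @ [u])" by simp
  moreover have "(x = u \<and> y = v) \<or> (x = v \<and> y = u)" using uv(1) by (auto simp: doubleton_eq_iff)
  ultimately show ?thesis using uv(2) P_len[OF assms] P_dist[OF assms]
    by (metis distinct_rev length_rev set_rev)
qed

text \<open>A vertex \<open>x\<close> linking the hubs in \<open>\<pi> x\<close> becomes the middle
  of a path made of the two pieces from \<open>x\<close> to these hubs, of length
  \<open>l + 1 + l\<close>. Injectivity of \<open>\<pi>\<close> assigns one such path to each new
  edge.\<close>

lemma link_subdivision:
  assumes hub: "H \<subseteq> B" and Ls: "L \<subseteq> B - H" and inj: "inj_on \<pi> L"
    and \<pi>: "\<And>x. x \<in> L \<Longrightarrow> \<pi> x \<subseteq> H \<and> card (\<pi> x) = 2 \<and> (\<forall>y\<in>\<pi> x. {x, y} \<in> E)"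
  shows "\<exists>Q. induced_subdivision adj V (2 * l + 1) H (\<pi> ` L) Q"
proof -
  have "\<exists>q. (\<exists>y z. \<pi> x = {y, z} \<and> successively adj (y # q @ [z])) \<and> length q = 2 * l + 1 \<and> distinct q
      \<and> set q = insert x (\<Union>y\<in>\<pi> x. set (P {x, y}))" if x: "x \<in> L" for x
  proof -
    obtain y z where yz: "\<pi> x = {y, z}" "y \<noteq> z" using \<pi>[OF x] by (auto simp: card_2_iff)
    have e: "{y, x} \<in> E" "{x, z} \<in> E" using \<pi>[OF x] yz by (auto simp: insert_commute)
    obtain p where p: "set p = set (P {y, x})" "distinct p" "length p = l" "successively adj (y # p @ [x])"
      using oriented_path[OF e(1)] by auto
    obtain q where q: "set q = set (P {x, z})" "distinct q" "length q = l" "successively adj (x # q @ [z])"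
      using oriented_path[OF e(2)] by auto
    have xB: "x \<in> B" using x Ls by auto
    have "successively adj (y # (p @ [x] @ q) @ [z])"
      using p(4) q(4) by (auto simp: successively_append_iff successively_Cons hd_append split: if_splits)
    moreover have "distinct (p @ [x] @ q)"
    proof -
      have "{y, x} \<noteq> {x, z}" using yz by (auto simp: doubleton_eq_iff)
      then have "set p \<inter> set q = {}" using P_disj[OF e] p q by auto
      moreover have "x \<notin> set p" "x \<notin> set q" using P_sub[OF e(1)] P_sub[OF e(2)] p q xB by auto
      ultimately show ?thesis using p q by auto
    qed
    moreover have "set (p @ [x] @ q) = insert x (\<Union>y\<in>\<pi> x. set (P {x, y}))"
      using p q yz by (auto simp: insert_commute)
    moreover have "length (p @ [x] @ q) = 2 * l + 1" using p q by simp
    ultimately show ?thesis using yz by blast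
  qed
  then obtain q where q: "\<And>x. x \<in> L \<Longrightarrow> (\<exists>y z. \<pi> x = {y, z} \<and> successively adj (y # q x @ [z])) \<and>
      length (q x) = 2 * l + 1 \<and> distinct (q x) \<and> set (q x) = insert x (\<Union>y\<in>\<pi> x. set (P {x, y}))"
    by metis
  define Q where "Q = (\<lambda>e. q (the_inv_into L \<pi> e))"
  have Q: "Q (\<pi> x) = q x" if "x \<in> L" for x
    using the_inv_into_f_f[OF inj that] by (simp add: Q_def)
  have ed: "{x, y} \<in> E" "y \<in> H" "x \<noteq> y" if "x \<in> L" "y \<in> \<pi> x" for x y
    using \<pi> that Ls by auto
  have nx: "x \<notin> H" "x \<in> B" "x \<in> V" if "x \<in> L" for x using that Ls B_sub by auto
  have dj: "set (q x) \<inter> set (q x') = {} \<and> (\<forall>u\<in>set (q x). \<forall>v\<in>set (q x'). \<not> adj u v)"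
    if xx: "x \<in> L" "x' \<in> L" "x \<noteq> x'" for x x'
  proof -
    \<comment> \<open>Pieces at different link vertices belong to different edges, since link
      vertices lie outside \<open>H\<close> and hubs inside; so the old separation of pieces carries
      over.\<close>
    have ne: "{x, y} \<noteq> {x', y'}" if "y \<in> \<pi> x" "y' \<in> \<pi> x'" for y y'
      using ed[OF xx(1) that(1)] ed[OF xx(2) that(2)] nx[OF xx(1)] nx[OF xx(2)] xx(3)
      by (auto simp: doubleton_eq_iff)
    have "u \<noteq> v \<and> \<not> adj u v" if uv: "u \<in> set (q x)" "v \<in> set (q x')" for u v
    proof -
      from uv q[OF xx(1)] q[OF xx(2)]
      have "u = x \<or> (\<exists>y\<in>\<pi> x. u \<in> set (P {x, y}))" "v = x' \<or> (\<exists>y\<in>\<pi> x'. v \<in> set (P {x', y}))" by auto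
      then consider "u = x" "v = x'" | y' where "u = x" "y' \<in> \<pi> x'" "v \<in> set (P {x', y'})"
        | y where "v = x'" "y \<in> \<pi> x" "u \<in> set (P {x, y})"
        | y y' where "y \<in> \<pi> x" "u \<in> set (P {x, y})" "y' \<in> \<pi> x'" "v \<in> set (P {x', y'})" by blast
      then show ?thesis
      proof cases
        case 1
        then show ?thesis using xx nx B_indep by auto
      next
        case 2
        note e = ed[OF xx(2) 2(2)]
        have "\<not> adj v x" using P_adj_B[OF e(1) 2(3) nx(2)[OF xx(1)]] e nx[OF xx(1)] xx by auto
        moreover have "v \<notin> B" using P_sub[OF e(1)] 2 by auto
        ultimately show ?thesis using 2 nx[OF xx(1)] adj_sym by auto
      next
        case 3
        note e = ed[OF xx(1) 3(2)]
        have "\<not> adj u x'" using P_adj_B[OF e(1) 3(3) nx(2)[OF xx(2)]] e nx[OF xx(2)] xx by auto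
        moreover have "u \<notin> B" using P_sub[OF e(1)] 3 by auto
        ultimately show ?thesis using 3 nx[OF xx(2)] adj_sym by auto
      next
        case 4
        note e = ed(1)[OF xx(1) 4(1)] and e' = ed(1)[OF xx(2) 4(3)]
        show ?thesis using P_nonadj[OF e e' ne[OF 4(1,3)] 4(2,4)] P_disj[OF e e' ne[OF 4(1,3)]] 4 by auto
      qed
    qed
    then show ?thesis by auto
  qed
  have "induced_subdivision adj V (2 * l + 1) H (\<pi> ` L) Q"
  proof
    fix e assume "e \<in> \<pi> ` L"
    then obtain x where x: "x \<in> L" "e = \<pi> x" by auto
    show "e \<subseteq> H \<and> card e = 2" using \<pi> x by auto
    show "length (Q e) = 2 * l + 1" "distinct (Q e)"
      "\<exists>x y. e = {x, y} \<and> successively adj (x # Q e @ [y])" using q[OF x(1)] Q[OF x(1)] x(2) by auto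
    have "set (P {x, y}) \<subseteq> V - H" if "y \<in> \<pi> x" for y
      using P_sub[OF ed(1)[OF x(1) that]] hub by auto
    then show "set (Q e) \<subseteq> V - H" using q[OF x(1)] Q[OF x(1)] x(2) nx[OF x(1)] by auto
    fix v z assume v: "v \<in> set (Q e)" and z: "z \<in> H" and a: "adj v z"
    have "v = x \<or> (\<exists>y\<in>\<pi> x. v \<in> set (P {x, y}))" using v q[OF x(1)] Q[OF x(1)] x(2) by auto
    moreover have "v \<noteq> x" using a B_indep nx[OF x(1)] z hub by auto
    ultimately obtain y where y: "y \<in> \<pi> x" "v \<in> set (P {x, y})" by auto
    have "z \<in> {x, y}" using P_adj_B[OF ed(1)[OF x(1) y(1)] y(2) _ a] z hub by auto
    then show "z \<in> e" using y x z nx[OF x(1)] by auto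
  next
    fix e f assume ef: "e \<in> \<pi> ` L" "f \<in> \<pi> ` L" "e \<noteq> f"
    then obtain x x' where x: "x \<in> L" "e = \<pi> x" "x' \<in> L" "f = \<pi> x'" by auto
    then show "set (Q e) \<inter> set (Q f) = {}" using dj[of x x'] Q ef by auto
  next
    fix e f u v assume ef: "e \<in> \<pi> ` L" "f \<in> \<pi> ` L" "e \<noteq> f" "u \<in> set (Q e)" "v \<in> set (Q f)"
    then obtain x x' where x: "x \<in> L" "e = \<pi> x" "x' \<in> L" "f = \<pi> x'" by auto
    then show "\<not> adj u v" using dj[of x x'] Q ef by auto
  next
    fix x y assume "x \<in> H" "y \<in> H"
    then show "\<not> adj x y" using B_indep hub by blast
  qed (use fin_V adj_sym B_sub hub in auto)
  then show ?thesis by blast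
qed

end

lemma distinct_pairs_or_clique:
  fixes h :: "'a \<Rightarrow> 'b set"
  assumes "finite L"
  shows "(\<exists>\<pi>. inj_on \<pi> L \<and> (\<forall>x\<in>L. \<pi> x \<subseteq> h x \<and> card (\<pi> x) = 2)) \<or>
    (\<exists>x\<in>L. \<exists>L0\<subseteq>L. \<exists>\<pi>. inj_on \<pi> L0 \<and> (\<forall>z\<in>L0. \<pi> z \<subseteq> h z \<and> card (\<pi> z) = 2)
      \<and> {e. e \<subseteq> h x \<and> card e = 2} \<subseteq> \<pi> ` L0)"
  using assms
proof (induction L rule: finite_induct)
  case empty
  show ?case by auto
next
  case (insert x L)
  from insert.IH show ?case
  proof (elim disjE exE bexE conjE)
    fix \<pi> assume \<pi>: "inj_on \<pi> L" "\<forall>x\<in>L. \<pi> x \<subseteq> h x \<and> card (\<pi> x) = 2"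
    show ?thesis
    proof (cases "{e. e \<subseteq> h x \<and> card e = 2} \<subseteq> \<pi> ` L")
      case True
      then show ?thesis using \<pi> by (intro disjI2 bexI[of _ x] exI[of _ L]) auto
    next
      case False
      then obtain e where e: "e \<subseteq> h x" "card e = 2" "e \<notin> \<pi> ` L" by auto
      have "(\<pi>(x := e)) ` L = \<pi> ` L" using insert.hyps by (intro image_cong) auto
      then have "inj_on (\<pi>(x := e)) (insert x L)"
        using \<pi>(1) e(3) insert.hyps(2) by (auto simp: inj_on_def)
      moreover have "\<forall>z\<in>insert x L. (\<pi>(x := e)) z \<subseteq> h z \<and> card ((\<pi>(x := e)) z) = 2"
        using \<pi> e insert.hyps by auto
      ultimately show ?thesis by blast
    qed
  next
    fix y L0 \<pi> assume "y \<in> L" "L0 \<subseteq> L" "inj_on \<pi> L0" "\<forall>z\<in>L0. \<pi> z \<subseteq> h z \<and> card (\<pi> z) = 2"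
      "{e. e \<subseteq> h y \<and> card e = 2} \<subseteq> \<pi> ` L0"
    then show ?thesis by (intro disjI2 bexI[of _ y] exI[of _ L0]) auto
  qed
qed

text \<open>A set of least size among those of density at least \<open>M / a\<close> is denser than
  all its proper nonempty subsets. The fraction is used with \<open>a = 1\<close> and
  \<open>a = 4\<close>.\<close>

lemma minimal_dense_subset:
  fixes E :: "'a set set"
  assumes "finite B" "B \<noteq> {}" "M * card B \<le> a * card {e \<in> E. e \<subseteq> B}"
  obtains B' where "B' \<subseteq> B" "B' \<noteq> {}" "M * card B' \<le> a * card {e \<in> E. e \<subseteq> B'}"
    "\<And>Z. Z \<subset> B' \<Longrightarrow> Z \<noteq> {} \<Longrightarrow> a * card {e \<in> E. e \<subseteq> Z} < M * card Z"
proof -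
  let ?P = "\<lambda>Z. Z \<subseteq> B \<and> Z \<noteq> {} \<and> M * card Z \<le> a * card {e \<in> E. e \<subseteq> Z}"
  obtain B' where B': "?P B'" "\<And>Z. ?P Z \<Longrightarrow> card B' \<le> card Z"
    using ex_has_least_nat[of ?P B card] assms by auto
  show ?thesis
  proof
    fix Z assume Z: "Z \<subset> B'" "Z \<noteq> {}"
    have "card Z < card B'" using Z B' assms(1) by (meson finite_subset psubset_card_mono)
    then have "\<not> ?P Z" using B'(2) leD by blast
    then show "a * card {e \<in> E. e \<subseteq> Z} < M * card Z" using Z B' by auto
  qed (use B' in auto)
qed

text \<open>If no edge left \<open>Z\<close>, all edges would lie within \<open>Z\<close> or within
  \<open>B - Z\<close>, and two densities below \<open>M / a\<close> cannot average to
  \<open>M / a\<close>.\<close>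

lemma crossing_minimal_dense:
  assumes fin: "finite B" and E: "\<And>e. e \<in> E \<Longrightarrow> card e = 2"
    and dense: "M * card B \<le> a * card {e \<in> E. e \<subseteq> B}"
    and min: "\<And>Z. Z \<subset> B \<Longrightarrow> Z \<noteq> {} \<Longrightarrow> a * card {e \<in> E. e \<subseteq> Z} < M * card Z"
  shows "crossing {e \<in> E. e \<subseteq> B} B"
  unfolding crossing_def
proof (intro allI impI)
  fix Z assume Z: "Z \<subset> B" "Z \<noteq> {}"
  show "\<exists>x\<in>Z. \<exists>y\<in>B - Z. {x, y} \<in> {e \<in> E. e \<subseteq> B}"
  proof (rule ccontr)
    assume no: "\<not> (\<exists>x\<in>Z. \<exists>y\<in>B - Z. {x, y} \<in> {e \<in> E. e \<subseteq> B})"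
    have sub: "{e \<in> E. e \<subseteq> B} \<subseteq> {e \<in> E. e \<subseteq> Z} \<union> {e \<in> E. e \<subseteq> B - Z}"
    proof
      fix e assume e: "e \<in> {e \<in> E. e \<subseteq> B}"
      then obtain x y where xy: "e = {x, y}" using E card_2_iff by (metis mem_Collect_eq)
      then have "{x, y} \<in> {e \<in> E. e \<subseteq> B}" "{y, x} \<in> {e \<in> E. e \<subseteq> B}" using e by (auto simp: insert_commute)
      then show "e \<in> {e \<in> E. e \<subseteq> Z} \<union> {e \<in> E. e \<subseteq> B - Z}" using no xy by auto
    qed
    have fi: "finite {e \<in> E. e \<subseteq> W}" if "W \<subseteq> B" for W
      by (rule finite_subset[of _ "Pow B"]) (use that fin in auto)
    have "card {e \<in> E. e \<subseteq> B} \<le> card ({e \<in> E. e \<subseteq> Z} \<union> {e \<in> E. e \<subseteq> B - Z})"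
      using card_mono[OF _ sub] fi Z by auto
    also have "\<dots> \<le> card {e \<in> E. e \<subseteq> Z} + card {e \<in> E. e \<subseteq> B - Z}" by (rule card_Un_le)
    finally have "a * card {e \<in> E. e \<subseteq> B} \<le> a * card {e \<in> E. e \<subseteq> Z} + a * card {e \<in> E. e \<subseteq> B - Z}"
      using mult_le_mono2 unfolding distrib_left[symmetric] by blast
    also have "\<dots> < M * card Z + M * card (B - Z)"
      using min[of Z] min[of "B - Z"] Z by (intro add_strict_mono) auto
    also have "\<dots> = M * (card Z + card (B - Z))" by (simp add: distrib_left)
    also have "card Z + card (B - Z) = card B"
      using Z fin card_mono[of B Z] card_Diff_subset[of Z B] finite_subset[of Z B] by auto
    finally show False using dense by simp
  qed
qed

lemma sum_degrees:
  assumes "finite B" "finite E" "\<And>e. e \<in> E \<Longrightarrow> e \<subseteq> B \<and> card e = 2"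
  shows "(\<Sum>x\<in>B. card {e \<in> E. x \<in> e}) = 2 * card E"
proof -
  have "{x \<in> B. x \<in> e} = e" if "e \<in> E" for e using assms(3)[OF that] by auto
  then have "\<forall>e\<in>E. card {x \<in> B. x \<in> e} = 2" using assms(3) by auto
  from sum_multicount[OF assms(1,2) this] show ?thesis .
qed

lemma card_neighbours_le:
  assumes "finite E"
  shows "card {y \<in> B. {x, y} \<in> E} \<le> card {e \<in> E. x \<in> e}"
proof (rule card_inj_on_le[of "\<lambda>y. {x, y}"])
  show "inj_on (\<lambda>y. {x, y}) {y \<in> B. {x, y} \<in> E}" by (auto simp: inj_on_def doubleton_eq_iff)
qed (use assms in auto)

text \<open>The exponent makes \<open>dense_bound c (2 * l + 1)\<close> the fourth power of \<open>dense_bound c l\<close>, as used when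
  paths of length \<open>l\<close> are joined in pairs.\<close>

definition dense_bound :: "nat \<Rightarrow> nat \<Rightarrow> nat" where
  "dense_bound c l = (2 * c) ^ (50 * (l + 1) ^ 2)"

text \<open>The factor \<open>l + 1\<close>, due to the types, is absorbed through
  \<open>l + 1 \<le> 2 ^ (l + 1)\<close>; this explains the base \<open>2 * c\<close> and the
  quadratic exponent in \<open>dense_bound\<close>.\<close>

lemma base_bound:
  fixes c l :: nat
  assumes "1 \<le> c"
  shows "(c * (l + 1)) ^ (9 * l) \<le> (2 * c) ^ (9 * (l + 1) ^ 2)"
proof -
  have "c \<le> c ^ (l + 1)" using assms self_le_power[of c "l + 1"] by simp
  moreover have "l + 1 \<le> 2 ^ (l + 1)" using less_exp[of "l + 1"] by simp
  ultimately have "c * (l + 1) \<le> c ^ (l + 1) * 2 ^ (l + 1)" by (rule mult_le_mono)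
  then have "c * (l + 1) \<le> (2 * c) ^ (l + 1)" by (simp add: power_mult_distrib mult_ac)
  then have "(c * (l + 1)) ^ (9 * l) \<le> ((2 * c) ^ (l + 1)) ^ (9 * l)" by (rule power_mono) simp
  also have "\<dots> = (2 * c) ^ ((l + 1) * (9 * l))" by (rule power_mult[symmetric])
  also have "\<dots> \<le> (2 * c) ^ (9 * (l + 1) ^ 2)"
    by (rule power_increasing) (use assms in \<open>auto simp: power2_eq_square algebra_simps\<close>)
  finally show ?thesis .
qed

text \<open>With \<open>M = 256 * q\<close>, the two inequalities contradict
  \<open>count_bound\<close>: the first for non-hubs, of degree at most
  \<open>6 * M * dense_bound c (2 * l + 1)\<close>, with \<open>k = 8 * q\<close>; the second for a
  complete graph on \<open>32 * q = M / 8\<close> hubs, with paths of length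
  \<open>2 * l + 1\<close> and \<open>k = q\<close>.\<close>

lemma dense_bound_arith:
  fixes c l :: nat
  assumes c: "1 \<le> c"
  obtains q where "0 < q" "dense_bound c l = 256 * q"
    "2 * (2 * (256 * q) * (3 * dense_bound c (2 * l + 1))) * (c * (l + 1)) ^ (9 * l) < (8 * q) ^ 7"
    "2 * (32 * q) * (c * (2 * l + 1 + 1)) ^ (9 * (2 * l + 1)) < q ^ 7"
proof -
  define N where "N = (l + 1) ^ 2"
  have N: "1 \<le> N" by (simp add: N_def)
  define z where "z = (2 * c) ^ N"
  have "2 \<le> 2 * c" using c by simp
  also have "2 * c \<le> z" using c N self_le_power[of "2 * c" N] by (simp add: z_def)
  finally have z: "2 \<le> z" .
  have zk: "(2 * c) ^ (k * N) = z ^ k" for k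
    unfolding z_def power_mult[symmetric] by (simp only: mult_ac)
  have db: "dense_bound c l = z ^ 50" unfolding dense_bound_def using zk[of 50] by (simp only: N_def)
  have N4: "(2 * l + 1 + 1) ^ 2 = 4 * N" by (simp add: N_def power2_eq_square algebra_simps)
  have db2: "dense_bound c (2 * l + 1) = (z ^ 50) ^ 4"
    unfolding dense_bound_def N4 using zk[of "50 * 4"] unfolding power_mult[symmetric] by (simp only: mult.assoc)
  \<comment> \<open>This is \<open>z ^ 50\<close> divided by 256, written without division: as
    \<open>z = (2 * c) ^ N\<close> and \<open>1 \<le> N\<close>, eight factors 2 can be removed from
    \<open>z ^ 8\<close>.\<close>
  define q where "q = z ^ 42 * (c ^ N) ^ 8 * 2 ^ (8 * N - 8)"
  have "2 ^ (8 * N - 8) * 2 ^ 8 = (2 :: nat) ^ (8 * N)" using N by (subst power_add[symmetric]) simp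
  then have "256 * q = z ^ 42 * ((c ^ N) ^ 8 * 2 ^ (8 * N))" by (simp add: q_def)
  also have "(c ^ N) ^ 8 * 2 ^ (8 * N) = z ^ 8"
    by (simp add: z_def power_mult_distrib mult_ac flip: power_mult)
  finally have q256: "256 * q = z ^ 50" by (simp add: power_add[symmetric])
  have z42: "z ^ 42 \<le> q" using c by (simp add: q_def)
  have q0: "0 < q" using q256 z by (metis mult_0_right not_gr_zero not_numeral_le_zero power_eq_0_iff)
  have X: "(c * (l + 1)) ^ (9 * l) \<le> z ^ 9"
    using base_bound[OF c, of l] zk[of 9] by (simp only: N_def)
  have Y: "(c * (2 * l + 1 + 1)) ^ (9 * (2 * l + 1)) \<le> z ^ 36"
    using base_bound[OF c, of "2 * l + 1"] zk[of "9 * 4"] unfolding N4 by (simp add: mult.assoc)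
  have two: "2 ^ n \<le> z ^ n" for n using z by (rule power_mono) simp
  have "2 * (2 * (256 * q) * (3 * dense_bound c (2 * l + 1))) * (c * (l + 1)) ^ (9 * l)
      \<le> 2 * (2 * (256 * q) * (3 * (z ^ 50) ^ 4)) * z ^ 9"
    unfolding db2 using X by (intro mult_left_mono) auto
  also have "\<dots> = 12 * 256 ^ 5 * q ^ 5 * z ^ 9"
  proof -
    have "w * w ^ 4 = w ^ 5" for w :: nat by (simp add: numeral_eq_Suc)
    from this[of "256 * q"] show ?thesis unfolding q256[symmetric] by (simp add: power_mult_distrib)
  qed
  also have "\<dots> \<le> 2 ^ 44 * q ^ 5 * z ^ 9" by (intro mult_right_mono) auto
  also have "\<dots> \<le> z ^ 44 * q ^ 5 * z ^ 9" using two[of 44] by (intro mult_right_mono) auto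
  also have "\<dots> = q ^ 5 * z ^ 53" by (simp add: power_add[symmetric])
  also have "\<dots> \<le> q ^ 5 * (z ^ 42) ^ 2"
    using z by (intro mult_left_mono) (auto simp: power_mult[symmetric] intro!: power_increasing)
  also have "\<dots> \<le> q ^ 5 * q ^ 2" using z42 by (intro mult_left_mono power_mono) auto
  also have "\<dots> = q ^ 7" by (simp add: power_add[symmetric])
  also have "\<dots> < (8 * q) ^ 7" using q0 by (simp add: power_mult_distrib)
  finally have 1: "2 * (2 * (256 * q) * (3 * dense_bound c (2 * l + 1))) * (c * (l + 1)) ^ (9 * l) < (8 * q) ^ 7" .
  have "2 * (32 * q) * (c * (2 * l + 1 + 1)) ^ (9 * (2 * l + 1)) \<le> 2 * (32 * q) * z ^ 36"
    using Y by (intro mult_left_mono) auto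
  also have "\<dots> = 2 ^ 6 * q * z ^ 36" by simp
  also have "\<dots> \<le> z ^ 6 * q * z ^ 36" using two[of 6] by (intro mult_right_mono) auto
  also have "\<dots> = q * z ^ 42" by (simp add: power_add[symmetric])
  also have "\<dots> < q * (z ^ 42) ^ 6"
    using z q0 by (intro mult_strict_left_mono) (auto simp: power_mult[symmetric] intro!: power_strict_increasing)
  also have "\<dots> \<le> q * q ^ 6" using z42 by (intro mult_left_mono power_mono) auto
  also have "\<dots> = q ^ 7" by (simp add: power_Suc[symmetric] del: power_Suc)
  finally have 2: "2 * (32 * q) * (c * (2 * l + 1 + 1)) ^ (9 * (2 * l + 1)) < q ^ 7" .
  show ?thesis using that[OF q0 _ 1 2] db q256 by simp
qed

lemma crossing_complete: "crossing {e. e \<subseteq> B \<and> card e = 2} B"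
  unfolding crossing_def
proof (intro allI impI)
  fix Z assume "Z \<subset> B" "Z \<noteq> {}"
  then obtain x y where "x \<in> Z" "y \<in> B - Z" by blast
  moreover from this have "card {x, y} = 2" by (metis DiffD2 card_2_iff)
  ultimately show "\<exists>x\<in>Z. \<exists>y\<in>B - Z. {x, y} \<in> {e. e \<subseteq> B \<and> card e = 2}"
    using \<open>Z \<subset> B\<close> by blast
qed

text \<open>Inside the minimal dense part, call a vertex of huge degree a hub.  If the non-hubs still
  span a positive proportion of the edges, \<open>count_bound\<close> applies to them.  Otherwise most vertices have
  many hub neighbours, and the far fewer hubs carry a denser graph with longer pieces.\<close>

theorem no_dense_subdivision:
  fixes adj :: "'a \<Rightarrow> 'a \<Rightarrow> bool"
  assumes "induced_subdivision adj V l B E P" "B \<noteq> {}" "1 \<le> c"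
    and small: "\<And>m. card (patterns adj V m) \<le> fact m * c ^ m"
  shows "card E < dense_bound c l * card B"
  using assms(1,2)
proof (induction "card B" arbitrary: l B E P rule: less_induct)
  case less
  interpret S: induced_subdivision adj V l B E P by fact
  note c = \<open>1 \<le> c\<close>
  obtain q where q: "0 < q" "dense_bound c l = 256 * q"
    "2 * (2 * (256 * q) * (3 * dense_bound c (2 * l + 1))) * (c * (l + 1)) ^ (9 * l) < (8 * q) ^ 7"
    "2 * (32 * q) * (c * (2 * l + 1 + 1)) ^ (9 * (2 * l + 1)) < q ^ 7"
    using dense_bound_arith[OF c] by metis
  define M where "M = 256 * q"
  define g where "g = dense_bound c (2 * l + 1)"
  define L where "L = 3 * g"
  have "2 ^ 3 \<le> (2 :: nat) ^ (50 * (2 * l + 1 + 1) ^ 2)"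
    by (rule power_increasing) (auto simp: power2_eq_square)
  also have "\<dots> \<le> g" unfolding g_def dense_bound_def using c by (intro power_mono) auto
  finally have g8: "8 \<le> g" by simp
  show ?case
  proof (rule ccontr)
    assume "\<not> card E < dense_bound c l * card B"
    then have dn: "M * card B \<le> 1 * card {e \<in> E. e \<subseteq> B}"
      using S.E_sub q by (simp add: M_def Collect_conj_eq Int_absorb2 subset_iff)
    obtain B1 where B1: "B1 \<subseteq> B" "B1 \<noteq> {}" "M * card B1 \<le> card {e \<in> E. e \<subseteq> B1}"
      "\<And>Z. Z \<subset> B1 \<Longrightarrow> Z \<noteq> {} \<Longrightarrow> card {e \<in> E. e \<subseteq> Z} < M * card Z"
      using minimal_dense_subset[OF S.fin_B less.prems(2) dn] by auto
    \<comment> \<open>Trimming to exactly \<open>M * card B1\<close> edges fixes the average degree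
      at \<open>2 * M\<close>, so that hubs are few, and makes the sparsity bound hold for
      \<open>B1\<close> itself as well as for its subsets.\<close>
    obtain E1 where E1: "E1 \<subseteq> {e \<in> E. e \<subseteq> B1}" "card E1 = M * card B1"
      using obtain_subset_with_card_n[OF B1(3)] by metis
    interpret S1: induced_subdivision adj V l B1 E1 P
      by (rule S.sub_subdivision) (use B1 E1 in auto)
    define b where "b = card B1"
    have b: "0 < b" using B1(2) S1.fin_B by (simp add: b_def card_gt_0_iff)
    have spars: "card {e \<in> E1. e \<subseteq> Z} \<le> M * card Z" if "Z \<subseteq> B1" for Z
    proof -
      note Z = that
      consider "Z = {}" | "Z = B1" | "Z \<subset> B1" "Z \<noteq> {}" using Z by blast
      then show ?thesis
      proof cases
        case 1
        then have "{e \<in> E1. e \<subseteq> Z} = {}" using S1.E_sub by fastforce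
        then show ?thesis by (metis card.empty zero_le)
      next
        case 2
        then show ?thesis using E1(2) card_mono[OF S1.fin_E, of "{e \<in> E1. e \<subseteq> Z}"] by auto
      next
        case 3
        have "card {e \<in> E1. e \<subseteq> Z} \<le> card {e \<in> E. e \<subseteq> Z}"
          using E1 S.fin_E by (intro card_mono) auto
        then show ?thesis using B1(4)[OF 3] by linarith
      qed
    qed
    \<comment> \<open>The threshold is \<open>L\<close> times the average degree, so hubs make up at
      most a fraction \<open>1 / L\<close> of \<open>B1\<close>.\<close>
    define H where "H = {x \<in> B1. 2 * M * L < card {e \<in> E1. x \<in> e}}"
    define W where "W = B1 - H"
    have fH: "finite H" "H \<subseteq> B1" and fW: "finite W" "W \<subseteq> B1"
      using S1.fin_B by (auto simp: H_def W_def)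
    have "card H * (2 * M * L) \<le> (\<Sum>x\<in>H. card {e \<in> E1. x \<in> e})"
      using sum_bounded_below[of H "2 * M * L" "\<lambda>x. card {e \<in> E1. x \<in> e}"] by (auto simp: H_def)
    also have "\<dots> \<le> (\<Sum>x\<in>B1. card {e \<in> E1. x \<in> e})"
      using fH S1.fin_B by (intro sum_mono2) auto
    also have "\<dots> = 2 * (M * b)"
      using sum_degrees[OF S1.fin_B S1.fin_E S1.E_sub] E1(2) by (simp add: b_def)
    finally have "(2 * M) * (card H * L) \<le> (2 * M) * b" by (simp add: mult_ac)
    then have HL: "card H * L \<le> b" using q by (simp add: M_def)
    show False
    proof (cases "M * b \<le> 4 * card {e \<in> E1. e \<subseteq> W}")
      case True
      have W0: "W \<noteq> {}"
      proof
        assume "W = {}"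
        then have "{e \<in> E1. e \<subseteq> W} = {}" using S1.E_sub by fastforce
        then have "M * b = 0" using True by (metis card.empty le_zero_eq mult_0_right)
        then show False using b q by (simp add: M_def)
      qed
      have MW: "M * card W \<le> 4 * card {e \<in> E1. e \<subseteq> W}"
        using True mult_le_mono2[OF card_mono[OF S1.fin_B fW(2)], of M] unfolding b_def by linarith
      \<comment> \<open>The edges among non-hubs need not form a connected graph; a minimal dense
        subset restores the connectedness that \<open>count_bound\<close> requires.\<close>
      obtain B2 where B2: "B2 \<subseteq> W" "B2 \<noteq> {}" "M * card B2 \<le> 4 * card {e \<in> E1. e \<subseteq> B2}"
        "\<And>Z. Z \<subset> B2 \<Longrightarrow> Z \<noteq> {} \<Longrightarrow> 4 * card {e \<in> E1. e \<subseteq> Z} < M * card Z"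
        by (rule minimal_dense_subset[OF fW(1) W0 MW]) (rule that)
      define E2 where "E2 = {e \<in> E1. e \<subseteq> B2}"
      interpret S2: induced_subdivision adj V l B2 E2 P
        by (rule S1.sub_subdivision) (use B2 fW E2_def in auto)
      have "crossing E2 B2" unfolding E2_def
        using crossing_minimal_dense[OF S2.fin_B _ B2(3,4)] S1.E_sub by blast
      moreover have "card {y \<in> B2. {x, y} \<in> E2} \<le> 2 * M * L" if "x \<in> B2" for x
      proof -
        have "card {y \<in> B2. {x, y} \<in> E2} \<le> card {e \<in> E2. x \<in> e}"
          by (rule card_neighbours_le[OF S2.fin_E])
        also have "\<dots> \<le> card {e \<in> E1. x \<in> e}"
          using S1.fin_E by (intro card_mono) (auto simp: E2_def)
        also have "\<dots> \<le> 2 * M * L" using that B2(1) unfolding W_def H_def by auto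
        finally show ?thesis .
      qed
      moreover have "1 \<le> 2 * M * L" using q g8 by (simp add: M_def L_def)
      \<comment> \<open>The density on \<open>B2\<close> is at least \<open>M / 4 = 64 * q\<close>,
        which covers \<open>56 * q + 1\<close>.\<close>
      moreover have "(7 * (8 * q) + 1) * card B2 \<le> card E2"
      proof -
        have "(7 * (8 * q) + 1) * card B2 \<le> (64 * q) * card B2" using q by (intro mult_right_mono) auto
        moreover have "4 * (64 * q * card B2) \<le> 4 * card E2" using B2(3) by (simp add: M_def E2_def)
        ultimately show ?thesis by linarith
      qed
      ultimately have "(8 * q) ^ 7 \<le> 2 * (2 * M * L) * (c * (l + 1)) ^ (9 * l)"
        using S2.count_bound[OF _ B2(2) _ _ small c] by blast
      then show False using q(3) by (simp add: M_def L_def g_def)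
    next
      case False
      define h where "h = (\<lambda>x. {y \<in> H. {x, y} \<in> E1})"
      define W' where "W' = {x \<in> W. M \<le> 8 * card (h x)}"
      define C where "C = {e \<in> E1. \<not> e \<subseteq> W \<and> \<not> e \<subseteq> H}"
      have fE1: "finite {e \<in> E1. Q e}" for Q using S1.fin_E by simp
      have "card E1 \<le> card ({e \<in> E1. e \<subseteq> W} \<union> ({e \<in> E1. e \<subseteq> H} \<union> C))"
        by (rule card_mono) (auto simp: C_def S1.fin_E)
      then have "card E1 \<le> card {e \<in> E1. e \<subseteq> W} + (card {e \<in> E1. e \<subseteq> H} + card C)"
        using card_Un_le[of "{e \<in> E1. e \<subseteq> W}" "{e \<in> E1. e \<subseteq> H} \<union> C"]
          card_Un_le[of "{e \<in> E1. e \<subseteq> H}" C] by linarith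
      moreover have H8: "8 * (M * card H) \<le> M * b"
      proof -
        have "8 \<le> L" using g8 by (simp add: L_def)
        then have "card H * 8 \<le> b" using HL mult_le_mono2[of 8 L "card H"] by linarith
        then have "M * (card H * 8) \<le> M * b" by (rule mult_le_mono2)
        then show ?thesis by (simp add: mult_ac)
      qed
      \<comment> \<open>Non-hubs span less than a quarter of the \<open>M * b\<close> edges and hubs
        at most \<open>M * card H\<close>, an eighth; so at least five eighths run between the
        two.\<close>
      ultimately have C5: "5 * (M * b) \<le> 8 * card C"
        using False spars[OF fH(2)] E1(2) unfolding b_def by linarith
      have fh: "finite (h x)" for x using fH by (simp add: h_def)
      have Csub: "C \<subseteq> {e \<in> E1. e \<subseteq> W' \<union> H} \<union> (\<Union>x\<in>W - W'. (\<lambda>y. {x, y}) ` h x)"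
      proof
        fix e assume e: "e \<in> C"
        then have eE: "e \<in> E1" by (simp add: C_def)
        have "e \<subseteq> B1" "card e = 2" using S1.E_sub[OF eE] by auto
        moreover have "\<not> e \<subseteq> W" "\<not> e \<subseteq> H" using e by (auto simp: C_def)
        ultimately obtain x y where xy: "e = {x, y}" "x \<in> W" "y \<in> H"
          unfolding card_2_iff W_def by auto
        then have "y \<in> h x" using eE by (simp add: h_def)
        then show "e \<in> {e \<in> E1. e \<subseteq> W' \<union> H} \<union> (\<Union>x\<in>W - W'. (\<lambda>y. {x, y}) ` h x)"
          using xy eE by (cases "x \<in> W'") auto
      qed
      have "8 * card (\<Union>x\<in>W - W'. (\<lambda>y. {x, y}) ` h x) \<le> 8 * (\<Sum>x\<in>W - W'. card ((\<lambda>y. {x, y}) ` h x))"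
        using fW by (intro mult_left_mono card_UN_le) auto
      also have "\<dots> \<le> (\<Sum>x\<in>W - W'. M)"
        unfolding sum_distrib_left
      proof (rule sum_mono)
        fix x assume "x \<in> W - W'"
        then have "8 * card (h x) \<le> M" by (auto simp: W'_def)
        then show "8 * card ((\<lambda>y. {x, y}) ` h x) \<le> M" using card_image_le[OF fh[of x], of "\<lambda>y. {x, y}"] by linarith
      qed
      also have "\<dots> \<le> M * b" using card_mono[of B1 "W - W'"] fW S1.fin_B by (auto simp: b_def)
      finally have C2: "8 * card (\<Union>x\<in>W - W'. (\<lambda>y. {x, y}) ` h x) \<le> M * b" .
      have W'W: "W' \<subseteq> W" "finite W'" using fW by (auto simp: W'_def)
      have "finite ({e \<in> E1. e \<subseteq> W' \<union> H} \<union> (\<Union>x\<in>W - W'. (\<lambda>y. {x, y}) ` h x))"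
        using fE1 fW fh by auto
      from card_mono[OF this Csub]
      have "card C \<le> card {e \<in> E1. e \<subseteq> W' \<union> H} + card (\<Union>x\<in>W - W'. (\<lambda>y. {x, y}) ` h x)"
        using card_Un_le le_trans by blast
      moreover have "card {e \<in> E1. e \<subseteq> W' \<union> H} \<le> M * (card W' + card H)"
      proof -
        have "W' \<union> H \<subseteq> B1" using W'W fW fH by auto
        from spars[OF this] show ?thesis using mult_le_mono2[OF card_Un_le[of W' H], of M] by linarith
      qed
      \<comment> \<open>Of the edges in \<open>C\<close>, those at vertices outside
        \<open>W'\<close> are at most an eighth of all edges. By sparsity the others number at most
        \<open>M * (card W' + card H)\<close>, where the hubs contribute another eighth.\<close>
      ultimately have "3 * (M * b) \<le> 8 * (M * card W')" using C5 C2 H8 unfolding distrib_left by linarith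
      moreover have "3 * (M * b) = M * (3 * b)" "8 * (M * card W') = M * (8 * card W')" by simp_all
      ultimately have "M * (3 * b) \<le> M * (8 * card W')" by (simp only:)
      then have W'b: "3 * b \<le> 8 * card W'" using q by (simp add: M_def)
      \<comment> \<open>The factor 3 in \<open>L = 3 * g\<close> pays for \<open>W'\<close> being
        guaranteed only three eighths of \<open>B1\<close>.\<close>
      have "9 * (g * card H) \<le> 8 * card W'" using HL W'b by (simp add: L_def mult_ac)
      then have gW: "g * card H \<le> card W'" by linarith
      have W'0: "W' \<noteq> {}" using W'b b by auto
      have link: "\<exists>Q. induced_subdivision adj V (2 * l + 1) H (\<pi> ` Y) Q"
        if "Y \<subseteq> W'" "inj_on \<pi> Y" "\<forall>x\<in>Y. \<pi> x \<subseteq> h x \<and> card (\<pi> x) = 2" for Y \<pi>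
        by (rule S1.link_subdivision) (use that W'W fH in \<open>auto simp: W_def h_def\<close>)
      from distinct_pairs_or_clique[OF W'W(2), of h] show False
      proof (elim disjE exE bexE conjE)
        fix \<pi> assume \<pi>: "inj_on \<pi> W'" "\<forall>x\<in>W'. \<pi> x \<subseteq> h x \<and> card (\<pi> x) = 2"
        obtain Q where Q: "induced_subdivision adj V (2 * l + 1) H (\<pi> ` W') Q" using link[OF _ \<pi>] by auto
        have H0: "H \<noteq> {}"
        proof -
          obtain x where "x \<in> W'" using W'0 by auto
          then have "\<pi> x \<subseteq> H" "card (\<pi> x) = 2" using \<pi> by (auto simp: h_def)
          then show ?thesis by auto
        qed
        have "card H < card B"
        proof -
          have "2 \<le> L" using g8 by (simp add: L_def)
          then have "card H * 2 \<le> card H * L" by (rule mult_le_mono2)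
          moreover have "0 < card H" using H0 fH by (simp add: card_gt_0_iff)
          ultimately have "card H < b" using HL by linarith
          then show ?thesis using card_mono[OF S.fin_B B1(1)] by (simp add: b_def)
        qed
        from less.hyps[OF this Q H0] show False using gW card_image[OF \<pi>(1)] by (simp add: g_def)
      next
        fix x Y \<pi> assume x: "x \<in> W'" and Y: "Y \<subseteq> W'" "inj_on \<pi> Y" "\<forall>z\<in>Y. \<pi> z \<subseteq> h z \<and> card (\<pi> z) = 2"
          and full: "{e. e \<subseteq> h x \<and> card e = 2} \<subseteq> \<pi> ` Y"
        obtain Q where Q: "induced_subdivision adj V (2 * l + 1) H (\<pi> ` Y) Q" using link[OF Y] by auto
        have "32 * q \<le> card (h x)" using x by (simp add: W'_def M_def)
        then obtain K where K: "K \<subseteq> h x" "card K = 32 * q" "finite K"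
          using obtain_subset_with_card_n by metis
        define E3 where "E3 = {e. e \<subseteq> K \<and> card e = 2}"
        have KH: "K \<subseteq> H" using K(1) by (auto simp: h_def)
        have E3\<pi>: "E3 \<subseteq> \<pi> ` Y"
        proof
          fix e assume "e \<in> E3"
          then have "e \<in> {e. e \<subseteq> h x \<and> card e = 2}" using K(1) by (auto simp: E3_def)
          then show "e \<in> \<pi> ` Y" using full by (rule subsetD[rotated])
        qed
        interpret S3: induced_subdivision adj V "2 * l + 1" K E3 Q
          by (rule induced_subdivision.sub_subdivision[OF Q KH E3\<pi>]) (simp add: E3_def)
        \<comment> \<open>The trivial degree bound is enough here, as the degrees of a complete
          graph are linear in its density.\<close>
        have nb: "card {y \<in> K. {z, y} \<in> E3} \<le> 32 * q" for z
          using card_mono[OF K(3), of "{y \<in> K. {z, y} \<in> E3}"] K(2) by auto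
        have "(7 * q + 1) * card K = 16 * q * (14 * q + 2)" by (simp add: K(2) algebra_simps)
        also have "\<dots> \<le> 16 * q * (32 * q - 1)" using q by (intro mult_le_mono2) auto
        also have "\<dots> = (32 * q) choose 2" by (simp add: choose_two)
        also have "\<dots> = card E3" unfolding E3_def using n_subsets[OF K(3), of 2] K(2) by simp
        finally have E3d: "(7 * q + 1) * card K \<le> card E3" .
        have K0: "K \<noteq> {}" using K q by auto
        have cr: "crossing E3 K" unfolding E3_def by (rule crossing_complete)
        have "1 \<le> 32 * q" using q by simp
        from S3.count_bound[OF cr K0 nb this small c E3d]
        have "q ^ 7 \<le> 2 * (32 * q) * (c * (2 * l + 1 + 1)) ^ (9 * (2 * l + 1))" .
        then show False using q(4) by simp
      qed
    qed
  qed
qed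

section \<open>Dense subdivisions in graphs of large degeneracy\<close>

text \<open>A vertex of degree at most \<open>d\<close> is ranked above all others, so that its
  earlier neighbours are all its neighbours, and the rest is ordered recursively.\<close>

lemma degeneracy_order:
  fixes adj :: "'a \<Rightarrow> 'a \<Rightarrow> bool"
  assumes "finite U" "\<And>W. W \<subseteq> U \<Longrightarrow> W \<noteq> {} \<Longrightarrow> \<exists>v\<in>W. card {u \<in> W. adj v u} \<le> d"
  shows "\<exists>r :: 'a \<Rightarrow> nat. inj_on r U \<and> (\<forall>v\<in>U. card {u \<in> U. adj v u \<and> r u < r v} \<le> d)"
  using assms
proof (induction "card U" arbitrary: U)
  case 0
  then show ?case by auto
next
  case (Suc n)
  then have "U \<noteq> {}" by auto
  then obtain v where v: "v \<in> U" "card {u \<in> U. adj v u} \<le> d" using Suc.prems(2)[of U] by auto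
  have "n = card (U - {v})" using Suc.hyps(2) v Suc.prems(1) by simp
  moreover have "\<exists>v\<in>W. card {u \<in> W. adj v u} \<le> d" if "W \<subseteq> U - {v}" "W \<noteq> {}" for W
    using Suc.prems(2)[of W] that by auto
  ultimately obtain r :: "'a \<Rightarrow> nat" where r: "inj_on r (U - {v})"
      "\<forall>w\<in>U - {v}. card {u \<in> U - {v}. adj w u \<and> r u < r w} \<le> d"
    using Suc.hyps(1)[of "U - {v}"] Suc.prems(1) by auto
  obtain m where m: "\<forall>i\<in>r ` U. i < m"
    using finite_nat_set_iff_bounded Suc.prems(1) by blast
  define s where "s = r(v := m)"
  have s: "s u = r u" "s u < m" if "u \<in> U" "u \<noteq> v" for u using that m by (auto simp: s_def)
  have sv: "s v = m" by (simp add: s_def)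
  have "inj_on s U"
  proof (rule inj_onI)
    fix x y assume xy: "x \<in> U" "y \<in> U" "s x = s y"
    show "x = y"
    proof (cases "x = v \<or> y = v")
      case True
      then show ?thesis using xy s sv by (metis less_irrefl)
    next
      case False
      then show ?thesis using xy s r(1) by (auto dest: inj_onD)
    qed
  qed
  moreover have "card {u \<in> U. adj w u \<and> s u < s w} \<le> d" if w: "w \<in> U" for w
  proof (cases "w = v")
    case True
    have "card {u \<in> U. adj w u \<and> s u < s w} \<le> card {u \<in> U. adj v u}"
      using Suc.prems(1) True by (intro card_mono) auto
    then show ?thesis using v(2) by linarith
  next
    case False
    have "{u \<in> U. adj w u \<and> s u < s w} \<subseteq> {u \<in> U - {v}. adj w u \<and> r u < r w}"
      using s[OF w False] sv s by (auto simp: s_def)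
    then have "card {u \<in> U. adj w u \<and> s u < s w} \<le> card {u \<in> U - {v}. adj w u \<and> r u < r w}"
      using Suc.prems(1) by (intro card_mono) auto
    also have "\<dots> \<le> d" using r(2) w False by auto
    finally show ?thesis .
  qed
  ultimately show ?case by blast
qed

section \<open>Edges and cliques in degenerate graphs\<close>

lemma sum_degrees_le:
  fixes adj :: "'a \<Rightarrow> 'a \<Rightarrow> bool" and r :: "'a \<Rightarrow> nat"
  assumes fin: "finite W" and sym: "\<And>u v. adj u v \<Longrightarrow> adj v u" and irr: "\<And>v. \<not> adj v v"
    and inj: "inj_on r W" and bkd: "\<And>v. v \<in> W \<Longrightarrow> card {u \<in> W. adj v u \<and> r u < r v} \<le> d"
  shows "(\<Sum>v\<in>W. card {u \<in> W. adj v u}) \<le> 2 * d * card W"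
proof -
  have split: "card {u \<in> W. adj v u} = card {u \<in> W. adj v u \<and> r u < r v} + card {u \<in> W. adj v u \<and> r v < r u}"
    if "v \<in> W" for v
  proof -
    have "{u \<in> W. adj v u} = {u \<in> W. adj v u \<and> r u < r v} \<union> {u \<in> W. adj v u \<and> r v < r u}"
      using inj irr that by (auto dest: inj_onD) (metis inj_onD linorder_neqE_nat)
    then show ?thesis using card_Un_disjoint[of "{u \<in> W. adj v u \<and> r u < r v}" "{u \<in> W. adj v u \<and> r v < r u}"] fin
      by fastforce
  qed
  have ind: "card {u \<in> W. Q u} = (\<Sum>u\<in>W. if Q u then 1 else 0)" for Q
    using fin by (simp add: sum.If_cases Int_def conj_commute)
  have "(\<Sum>v\<in>W. card {u \<in> W. adj v u \<and> r v < r u}) = (\<Sum>u\<in>W. \<Sum>v\<in>W. if adj v u \<and> r v < r u then 1 else 0)"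
    unfolding ind by (rule sum.swap)
  also have "\<dots> = (\<Sum>u\<in>W. card {v \<in> W. adj u v \<and> r v < r u})"
    unfolding ind by (intro sum.cong) (auto dest: sym)
  finally have "(\<Sum>v\<in>W. card {u \<in> W. adj v u}) = 2 * (\<Sum>v\<in>W. card {u \<in> W. adj v u \<and> r u < r v})"
    using split by (simp add: sum.distrib)
  also have "\<dots> \<le> 2 * (card W * d)" using sum_bounded_above[of W _ d] bkd by fastforce
  finally show ?thesis by (simp add: mult_ac)
qed

text \<open>A clique is determined by its last vertex and \<open>k\<close> of the at most
  \<open>d\<close> earlier neighbours of that vertex.\<close>

lemma card_cliques_le:
  fixes Q :: "'a \<Rightarrow> 'a \<Rightarrow> bool" and r :: "'a \<Rightarrow> nat"
  assumes fin: "finite U" and inj: "inj_on r U"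
    and bkd: "\<And>v. v \<in> U \<Longrightarrow> card {u \<in> U. Q v u \<and> r u < r v} \<le> d"
  shows "card {K. K \<subseteq> U \<and> card K = Suc k \<and> (\<forall>x\<in>K. \<forall>y\<in>K. x \<noteq> y \<longrightarrow> Q x y)} \<le> card U * d ^ k"
proof -
  define bk where "bk = (\<lambda>v. {u \<in> U. Q v u \<and> r u < r v})"
  have fbk: "finite (bk v)" for v using fin by (simp add: bk_def)
  let ?S = "Sigma U (\<lambda>v. {S. S \<subseteq> bk v \<and> card S = k})"
  have fS: "finite ?S" using fin fbk by (intro finite_SigmaI) auto
  have "{K. K \<subseteq> U \<and> card K = Suc k \<and> (\<forall>x\<in>K. \<forall>y\<in>K. x \<noteq> y \<longrightarrow> Q x y)} \<subseteq> (\<lambda>(v, S). insert v S) ` ?S"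
  proof
    fix K assume "K \<in> {K. K \<subseteq> U \<and> card K = Suc k \<and> (\<forall>x\<in>K. \<forall>y\<in>K. x \<noteq> y \<longrightarrow> Q x y)}"
    then have K: "K \<subseteq> U" "card K = Suc k" "\<And>x y. x \<in> K \<Longrightarrow> y \<in> K \<Longrightarrow> x \<noteq> y \<Longrightarrow> Q x y" by auto
    have fK: "finite K" "K \<noteq> {}" using K fin finite_subset by auto
    have "Max (r ` K) \<in> r ` K" using fK by (intro Max_in) auto
    then obtain v where v: "v \<in> K" "r v = Max (r ` K)" by auto
    have "r u < r v" if "u \<in> K" "u \<noteq> v" for u
    proof -
      have "r u \<le> r v" using that v fK by simp
      moreover have "r u \<noteq> r v" using that v K(1) inj by (meson inj_onD subsetD)
      ultimately show ?thesis by simp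
    qed
    then have "K - {v} \<subseteq> bk v" using K v by (auto simp: bk_def)
    moreover have "card (K - {v}) = k" using K(2) v fK by simp
    moreover have "K = insert v (K - {v})" using v by auto
    ultimately show "K \<in> (\<lambda>(v, S). insert v S) ` ?S" using v K(1) by (intro image_eqI[of _ _ "(v, K - {v})"]) auto
  qed
  then have "card {K. K \<subseteq> U \<and> card K = Suc k \<and> (\<forall>x\<in>K. \<forall>y\<in>K. x \<noteq> y \<longrightarrow> Q x y)} \<le> card ?S"
    using fS by (meson card_image_le card_mono finite_imageI le_trans)
  also have "\<dots> = (\<Sum>v\<in>U. card (bk v) choose k)"
    using fin fbk by (simp add: n_subsets)
  also have "\<dots> \<le> (\<Sum>v\<in>U. d ^ k)"
  proof (rule sum_mono)
    fix v assume "v \<in> U"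
    have "(card (bk v) choose k) \<le> card (bk v) ^ k"
      by (cases "k \<le> card (bk v)") (auto simp: binomial_le_pow binomial_eq_0)
    also have "\<dots> \<le> d ^ k" using bkd[OF \<open>v \<in> U\<close>] by (intro power_mono) (auto simp: bk_def)
    finally show "(card (bk v) choose k) \<le> d ^ k" .
  qed
  finally show ?thesis by simp
qed

section \<open>Random sampling, expressed by counting functions\<close>

lemma bernoulli_nat:
  fixes q z :: nat
  assumes "2 * z \<le> q" "0 < q"
  shows "q ^ z \<le> 2 * (q - 1) ^ z"
proof -
  have "1 / 2 \<le> 1 + real z * (- 1 / real q)" using assms by (simp add: field_simps)
  also have "\<dots> \<le> (1 + (- 1 / real q)) ^ z" using assms by (intro Bernoulli_inequality) simp
  also have "1 + (- 1 / real q) = real (q - 1) / real q" using assms by (simp add: field_simps of_nat_diff)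
  finally have "real (q ^ z) \<le> real (2 * (q - 1) ^ z)" using assms by (simp add: field_simps)
  then show ?thesis by (simp only: of_nat_le_iff)
qed

text \<open>A uniform function into \<open>{..<q}\<close> samples the vertices of value 0, each with
  probability \<open>1 / q\<close>. Given \<open>x\<close> and \<open>y\<close>, the set
  \<open>Z\<close> is missed with probability at least one half, so the event has probability at
  least \<open>1 / (2 * q ^ 2)\<close>.\<close>

lemma count_sparse_samples:
  fixes q :: nat
  assumes fin: "finite W" and xy: "x \<in> W" "y \<in> W" "x \<noteq> y" and Z: "Z \<subseteq> W - {x, y}"
    and q: "2 * card Z \<le> q" "0 < q"
  shows "q ^ card W \<le> 2 * q ^ 2 * card {f \<in> W \<rightarrow>\<^sub>E {..<q}. f x = 0 \<and> f y = 0 \<and> (\<forall>z\<in>Z. f z \<noteq> 0)}"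
proof -
  let ?A = "\<lambda>w. if w = x \<or> w = y then {0} else if w \<in> Z then {1..<q} else {..<q}"
  have sub: "?A w \<subseteq> {..<q}" for w using q by auto
  have eq: "{f \<in> W \<rightarrow>\<^sub>E {..<q}. f x = 0 \<and> f y = 0 \<and> (\<forall>z\<in>Z. f z \<noteq> 0)} = PiE W ?A"
  proof (intro set_eqI iffI)
    fix f assume f: "f \<in> {f \<in> W \<rightarrow>\<^sub>E {..<q}. f x = 0 \<and> f y = 0 \<and> (\<forall>z\<in>Z. f z \<noteq> 0)}"
    then have "f w \<in> ?A w" if "w \<in> W" for w using that by (fastforce simp: Suc_le_eq)
    then show "f \<in> PiE W ?A" using f by (auto simp: PiE_iff)
  next
    fix f assume f: "f \<in> PiE W ?A"
    have a: "f w \<in> ?A w" if "w \<in> W" for w using f that by (rule PiE_mem)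
    have "f w \<in> {..<q}" if "w \<in> W" for w using a[OF that] sub by blast
    moreover have "f x = 0" "f y = 0" using a[of x] a[of y] xy by auto
    moreover have "f z \<noteq> 0" if "z \<in> Z" for z
    proof -
      have "z \<in> W" "z \<noteq> x" "z \<noteq> y" using that Z by auto
      then show ?thesis using a[of z] that by simp
    qed
    ultimately show "f \<in> {f \<in> W \<rightarrow>\<^sub>E {..<q}. f x = 0 \<and> f y = 0 \<and> (\<forall>z\<in>Z. f z \<noteq> 0)}"
      using f by (auto simp: PiE_iff)
  qed
  define X where "X = W - ({x, y} \<union> Z)"
  have fZ: "finite Z" using Z fin finite_subset by blast
  have W: "W = {x, y} \<union> (Z \<union> X)" using xy Z by (auto simp: X_def)
  have dis: "{x, y} \<inter> (Z \<union> X) = {}" "Z \<inter> X = {}" "finite X" using Z fin by (auto simp: X_def)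
  have cW: "card W = 2 + (card Z + card X)"
  proof -
    have "card W = card ({x, y} \<union> (Z \<union> X))" using W by simp
    also have "\<dots> = card {x, y} + card (Z \<union> X)" using dis fZ by (intro card_Un_disjoint) auto
    also have "card (Z \<union> X) = card Z + card X" using dis fZ by (intro card_Un_disjoint) auto
    finally show ?thesis using xy by simp
  qed
  have "card (PiE W ?A) = (\<Prod>w\<in>W. card (?A w))" using fin by (simp add: card_PiE)
  also have "\<dots> = (\<Prod>w\<in>{x, y} \<union> (Z \<union> X). card (?A w))" using W by simp
  also have "\<dots> = (\<Prod>w\<in>{x, y}. card (?A w)) * ((\<Prod>w\<in>Z. card (?A w)) * (\<Prod>w\<in>X. card (?A w)))"
    using dis fZ by (subst prod.union_disjoint; simp add: prod.union_disjoint)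
  also have "(\<Prod>w\<in>{x, y}. card (?A w)) = 1" using xy by simp
  also have "(\<Prod>w\<in>Z. card (?A w)) = (\<Prod>w\<in>Z. q - 1)" using dis by (intro prod.cong) auto
  also have "(\<Prod>w\<in>X. card (?A w)) = (\<Prod>w\<in>X. q)" using dis by (intro prod.cong) auto
  finally have c: "card (PiE W ?A) = (q - 1) ^ card Z * q ^ card X" by simp
  have "q ^ card W = q ^ 2 * (q ^ card Z * q ^ card X)" unfolding cW by (simp add: power_add power2_eq_square)
  also have "\<dots> \<le> q ^ 2 * ((2 * (q - 1) ^ card Z) * q ^ card X)"
    using bernoulli_nat[OF q] by (intro mult_le_mono2 mult_le_mono1)
  finally show ?thesis unfolding eq c by (simp add: mult_ac)
qed

lemma count_single_samples:
  fixes q :: nat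
  assumes fin: "finite W" and x: "x \<in> W" and q: "0 < q"
  shows "q * card {f \<in> W \<rightarrow>\<^sub>E {..<q}. f x = 0} = q ^ card W"
proof -
  let ?A = "\<lambda>w. if w = x then {0} else {..<q}"
  have eq: "{f \<in> W \<rightarrow>\<^sub>E {..<q}. f x = 0} = PiE W ?A"
  proof (intro set_eqI iffI)
    fix f assume f: "f \<in> PiE W ?A"
    have a: "f w \<in> ?A w" if "w \<in> W" for w using f that by (rule PiE_mem)
    have "f w \<in> {..<q}" if "w \<in> W" for w using a[OF that] q by (simp split: if_splits)
    moreover have "f x = 0" using a[OF x] by simp
    ultimately show "f \<in> {f \<in> W \<rightarrow>\<^sub>E {..<q}. f x = 0}" using f by (simp add: PiE_iff)
  qed (simp add: PiE_iff)
  have "card (PiE W ?A) = (\<Prod>w\<in>W. card (?A w))" using fin by (simp add: card_PiE)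
  also have "\<dots> = card (?A x) * (\<Prod>w\<in>W - {x}. card (?A w))" by (rule prod.remove[OF fin x])
  also have "(\<Prod>w\<in>W - {x}. card (?A w)) = (\<Prod>w\<in>W - {x}. q)" by (intro prod.cong) auto
  finally have "card (PiE W ?A) = q ^ (card W - 1)" using x fin by simp
  moreover have "0 < card W" using x fin by (auto simp: card_gt_0_iff)
  ultimately show ?thesis unfolding eq by (metis power_eq_if less_not_refl2)
qed

text \<open>A set of size \<open>Suc k\<close> lies in at most \<open>k\<close> neighbourhoods, so the subsets of this size of the
  neighbourhoods of low degree vertices are almost distinct.  They are cliques of the common-neighbour
  graph \<open>Q\<close>, which is therefore much denser than \<open>adj\<close>.\<close>

lemma dense_common_neighbour_graph:
  fixes adj :: "'a \<Rightarrow> 'a \<Rightarrow> bool" and r :: "'a \<Rightarrow> nat"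
  assumes fin: "finite U" and ne: "U \<noteq> {}" and sym: "\<And>u v. adj u v \<Longrightarrow> adj v u"
    and irr: "\<And>v. \<not> adj v v"
    and sparse: "\<And>S T. S \<subseteq> U \<Longrightarrow> T \<subseteq> U \<Longrightarrow> card S = Suc k \<Longrightarrow> card T = Suc k \<Longrightarrow> \<exists>x\<in>S. \<exists>y\<in>T. \<not> adj x y"
    and mindeg: "\<And>v. v \<in> U \<Longrightarrow> Suc k * m \<le> card {u \<in> U. adj v u}"
    and inj: "inj_on r U"
    and bkd: "\<And>v. v \<in> U \<Longrightarrow> card {u \<in> U. adj v u \<and> r u < r v} \<le> Suc k * m"
    and m: "2 * Suc k * R ^ k < m"
  defines "Q \<equiv> \<lambda>x y. x \<noteq> y \<and> (\<exists>a\<in>U. card {u \<in> U. adj a u} \<le> 4 * (Suc k * m) \<and> adj a x \<and> adj a y)"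
  shows "\<exists>W\<subseteq>U. W \<noteq> {} \<and> (\<forall>v\<in>W. R * m < card {u \<in> W. Q v u})"
proof (rule ccontr)
  assume no: "\<not> ?thesis"
  define D where "D = Suc k * m"
  define nb where "nb = (\<lambda>a. {u \<in> U. adj a u})"
  \<comment> \<open>The average degree is at most \<open>2 * D\<close>, so at least half of the
    vertices have degree at most twice that.\<close>
  define V where "V = {v \<in> U. card (nb v) \<le> 4 * D}"
  define n where "n = card U"
  have n0: "0 < n" using fin ne by (simp add: n_def card_gt_0_iff)
  have D0: "0 < D" using m by (simp add: D_def)
  have fV: "finite V" "V \<subseteq> U" using fin by (auto simp: V_def)
  have fnb: "finite (nb a)" for a using fin by (simp add: nb_def)
  have "4 * D \<le> card (nb v)" if "v \<in> U - V" for v using that by (auto simp: V_def)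
  then have "card (U - V) * (4 * D) \<le> (\<Sum>v\<in>U - V. card (nb v))"
    using sum_bounded_below[of "U - V" "4 * D" "\<lambda>v. card (nb v)"] by simp
  also have "\<dots> \<le> (\<Sum>v\<in>U. card (nb v))" using fin by (intro sum_mono2) auto
  also have "\<dots> \<le> 2 * D * n"
    unfolding nb_def n_def using sum_degrees_le[OF fin sym irr inj bkd] by (simp add: D_def)
  finally have "(2 * D) * (2 * card (U - V)) \<le> (2 * D) * n" by (simp add: mult_ac)
  then have "2 * card (U - V) \<le> n" using D0 by simp
  moreover have "card (U - V) + card V = n"
    using fV fin card_mono[of U V] by (simp add: card_Diff_subset n_def)
  ultimately have nV: "n \<le> 2 * card V" by linarith
  define Ks where "Ks = {K. K \<subseteq> U \<and> card K = Suc k \<and> (\<exists>a\<in>V. K \<subseteq> nb a)}"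
  have fKs: "finite Ks" by (rule finite_subset[of _ "Pow U"]) (use fin in \<open>auto simp: Ks_def\<close>)
  define A where "A = Sigma V (\<lambda>a. {K. K \<subseteq> nb a \<and> card K = Suc k})"
  have fA: "finite A" unfolding A_def using fV fnb by (intro finite_SigmaI) auto
  have m0: "0 < m" using m by simp
  have "card V * m ^ Suc k \<le> (\<Sum>a\<in>V. card (nb a) choose Suc k)"
  proof -
    \<comment> \<open>The minimum degree is taken to be \<open>Suc k * m\<close> so that each
      neighbourhood has at least \<open>m ^ Suc k\<close> subsets of size
      \<open>Suc k\<close>.\<close>
    have "m ^ Suc k \<le> (card (nb a) choose Suc k)" if "a \<in> V" for a
    proof -
      have "m ^ Suc k \<le> (m * Suc k choose Suc k)" by (rule power_choose_le) (use m0 in auto)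
      also have "\<dots> \<le> (card (nb a) choose Suc k)"
        using mindeg[of a] that fV by (intro binomial_right_mono) (auto simp: nb_def mult_ac)
      finally show ?thesis .
    qed
    then show ?thesis using sum_bounded_below[of V "m ^ Suc k" "\<lambda>a. card (nb a) choose Suc k"] by simp
  qed
  also have "\<dots> = card A" unfolding A_def using fV fnb by (simp add: n_subsets)
  also have "\<dots> \<le> card Ks * Suc k"
  proof (rule card_le_mult_fibre[OF fA fKs, of snd])
    show "snd ` A \<subseteq> Ks" using fV by (fastforce simp: A_def Ks_def nb_def)
    fix p assume p: "p \<in> A"
    define K where "K = snd p"
    have K: "K \<subseteq> U" "card K = Suc k" using p by (auto simp: A_def K_def nb_def)
    have "card {p' \<in> A. snd p' = snd p} \<le> card {a \<in> V. K \<subseteq> nb a}"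
    proof (rule card_inj_on_le[of fst])
      show "inj_on fst {p' \<in> A. snd p' = snd p}" by (auto simp: inj_on_def)
      show "fst ` {p' \<in> A. snd p' = snd p} \<subseteq> {a \<in> V. K \<subseteq> nb a}" by (auto simp: A_def K_def)
    qed (use fV in auto)
    moreover have "card {a \<in> V. K \<subseteq> nb a} \<le> Suc k"
    proof (rule ccontr)
      assume "\<not> ?thesis"
      then have "Suc k \<le> card {a \<in> V. K \<subseteq> nb a}" by simp
      then obtain T where T: "T \<subseteq> {a \<in> V. K \<subseteq> nb a}" "card T = Suc k"
        using obtain_subset_with_card_n by metis
      then have "\<exists>x\<in>T. \<exists>y\<in>K. \<not> adj x y" using sparse[of T K] K fV by blast
      then show False using T by (auto simp: nb_def)
    qed
    ultimately show "card {p' \<in> A. snd p' = snd p} \<le> Suc k" by linarith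
  qed
  finally have VK: "card V * m ^ Suc k \<le> card Ks * Suc k" .
  \<comment> \<open>Without a subset of large minimum degree, \<open>Q\<close> is degenerate and has
    at most \<open>n * (R * m) ^ k\<close> cliques of size \<open>Suc k\<close>. This is one power
    of \<open>m\<close> short of the \<open>m ^ Suc k\<close> sets supplied by each low degree
    vertex.\<close>
  have "\<exists>v\<in>W. card {u \<in> W. Q v u} \<le> R * m" if "W \<subseteq> U" "W \<noteq> {}" for W
    using no that by (meson not_less)
  from degeneracy_order[OF fin this] obtain s :: "'a \<Rightarrow> nat" where s: "inj_on s U"
    "\<And>v. v \<in> U \<Longrightarrow> card {u \<in> U. Q v u \<and> s u < s v} \<le> R * m" by blast
  have "Ks \<subseteq> {K. K \<subseteq> U \<and> card K = Suc k \<and> (\<forall>x\<in>K. \<forall>y\<in>K. x \<noteq> y \<longrightarrow> Q x y)}"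
    unfolding Ks_def Q_def V_def nb_def D_def by blast
  then have "card Ks \<le> card {K. K \<subseteq> U \<and> card K = Suc k \<and> (\<forall>x\<in>K. \<forall>y\<in>K. x \<noteq> y \<longrightarrow> Q x y)}"
    using fin by (intro card_mono) auto
  also have "\<dots> \<le> n * (R * m) ^ k" unfolding n_def by (rule card_cliques_le[OF fin s])
  finally have Kn: "card Ks \<le> n * (R * m) ^ k" .
  have "n * m ^ Suc k \<le> 2 * card V * m ^ Suc k" using nV by (rule mult_le_mono1)
  also have "\<dots> \<le> 2 * (card Ks * Suc k)" using VK by simp
  also have "\<dots> \<le> 2 * (n * (R * m) ^ k * Suc k)" using Kn by (intro mult_le_mono2 mult_le_mono1)
  also have "\<dots> = (n * m ^ k) * (2 * Suc k * R ^ k)" by (simp only: power_mult_distrib mult_ac)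
  also have "n * m ^ Suc k = (n * m ^ k) * m" by (simp only: power_Suc mult_ac)
  finally have "(n * m ^ k) * m \<le> (n * m ^ k) * (2 * Suc k * R ^ k)" .
  moreover have "0 < n * m ^ k" using n0 m0 by simp
  ultimately have "m \<le> 2 * Suc k * R ^ k" by (simp only: nat_mult_le_cancel1)
  then show False using m by simp
qed

text \<open>Sample \<open>W\<close> with probability \<open>1 / q\<close>.  A non-adjacent pair with a common neighbour \<open>a\<close> survives if no
  other neighbour of \<open>a\<close> and no earlier neighbour of the pair is sampled.\<close>

lemma exists_dense_1_subdivision:
  fixes adj :: "'a \<Rightarrow> 'a \<Rightarrow> bool" and r :: "'a \<Rightarrow> nat"
  assumes fin: "finite U" and ne: "U \<noteq> {}" and sym: "\<And>u v. adj u v \<Longrightarrow> adj v u"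
    and irr: "\<And>v. \<not> adj v v"
    and sparse: "\<And>S T. S \<subseteq> U \<Longrightarrow> T \<subseteq> U \<Longrightarrow> card S = Suc k \<Longrightarrow> card T = Suc k \<Longrightarrow> \<exists>x\<in>S. \<exists>y\<in>T. \<not> adj x y"
    and mindeg: "\<And>v. v \<in> U \<Longrightarrow> Suc k * m \<le> card {u \<in> U. adj v u}"
    and inj: "inj_on r U"
    and bkd: "\<And>v. v \<in> U \<Longrightarrow> card {u \<in> U. adj v u \<and> r u < r v} \<le> Suc k * m"
    and m: "2 * Suc k * (56 * N * Suc k + 2 * Suc k + 1) ^ k < m"
  shows "\<exists>B E w. B \<subseteq> U \<and> B \<noteq> {} \<and> N * card B \<le> card E \<and> (\<forall>x\<in>B. \<forall>y\<in>B. \<not> adj x y) \<and>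
    (\<forall>e\<in>E. e \<subseteq> B \<and> card e = 2 \<and> w e \<in> U - B \<and> {u \<in> B. adj (w e) u} = e)"
proof -
  define D where "D = Suc k * m"
  define nb where "nb = (\<lambda>a. {u \<in> U. adj a u})"
  define bk where "bk = (\<lambda>v. {u \<in> U. adj v u \<and> r u < r v})"
  define Q where "Q = (\<lambda>x y. x \<noteq> y \<and> (\<exists>a\<in>U. card (nb a) \<le> 4 * D \<and> adj a x \<and> adj a y))"
  have "\<exists>W\<subseteq>U. W \<noteq> {} \<and> (\<forall>v\<in>W. (56 * N * Suc k + 2 * Suc k + 1) * m < card {u \<in> W. Q v u})"
    unfolding Q_def nb_def D_def
    by (rule dense_common_neighbour_graph[OF fin ne sym irr sparse mindeg inj bkd m])
  then obtain W where W: "W \<subseteq> U" "W \<noteq> {}" "\<And>v. v \<in> W \<Longrightarrow> (56 * N * Suc k + 2 * Suc k + 1) * m < card {u \<in> W. Q v u}"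
    by blast
  have m0: "0 < m" using m by simp
  have D0: "1 \<le> D" using m0 by (simp add: D_def)
  have fW: "finite W" "0 < card W" using W fin finite_subset by (auto simp: card_gt_0_iff)
  have fbk: "finite (bk v)" "finite (nb v)" for v using fin by (auto simp: bk_def nb_def)
  define Ps where "Ps = {(x, y). x \<in> W \<and> y \<in> W \<and> Q x y \<and> \<not> adj x y}"
  have fP: "finite Ps" by (rule finite_subset[of _ "W \<times> W"]) (use fW in \<open>auto simp: Ps_def\<close>)
  \<comment> \<open>Adjacent pairs cannot be used. The earlier-neighbour bound leaves at most
    \<open>2 * Suc k * m\<close> of them per vertex on average, which the summand
    \<open>2 * Suc k\<close> of the constant pays for.\<close>
  have cP: "(56 * N * Suc k + 1) * m * card W \<le> card Ps"
  proof -
    have "card W * ((56 * N * Suc k + 2 * Suc k + 1) * m) \<le> (\<Sum>v\<in>W. card {u \<in> W. Q v u})"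
      using sum_bounded_below[of W "(56 * N * Suc k + 2 * Suc k + 1) * m" "\<lambda>v. card {u \<in> W. Q v u}"] W(3)
      by (simp add: less_imp_le)
    also have "\<dots> \<le> (\<Sum>v\<in>W. card {u \<in> W. Q v u \<and> \<not> adj v u} + card {u \<in> W. adj v u})"
    proof (rule sum_mono)
      fix v
      have "card {u \<in> W. Q v u} \<le> card ({u \<in> W. Q v u \<and> \<not> adj v u} \<union> {u \<in> W. adj v u})"
        using fW by (intro card_mono) auto
      then show "card {u \<in> W. Q v u} \<le> card {u \<in> W. Q v u \<and> \<not> adj v u} + card {u \<in> W. adj v u}"
        using card_Un_le le_trans by blast
    qed
    also have "\<dots> = (\<Sum>v\<in>W. card {u \<in> W. Q v u \<and> \<not> adj v u}) + (\<Sum>v\<in>W. card {u \<in> W. adj v u})"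
      by (rule sum.distrib)
    also have "(\<Sum>v\<in>W. card {u \<in> W. Q v u \<and> \<not> adj v u}) = card Ps"
    proof -
      have "Ps = Sigma W (\<lambda>v. {u \<in> W. Q v u \<and> \<not> adj v u})" by (auto simp: Ps_def)
      then show ?thesis using fW by simp
    qed
    also have "(\<Sum>v\<in>W. card {u \<in> W. adj v u}) \<le> 2 * D * card W"
    proof (rule sum_degrees_le[OF fW(1) sym irr])
      show "inj_on r W" using inj W(1) inj_on_subset by blast
      fix v assume "v \<in> W"
      have "card {u \<in> W. adj v u \<and> r u < r v} \<le> card (bk v)"
        using W(1) fbk by (intro card_mono) (auto simp: bk_def)
      then show "card {u \<in> W. adj v u \<and> r u < r v} \<le> D"
        using bkd[of v] W(1) \<open>v \<in> W\<close> by (auto simp: bk_def D_def)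
    qed
    finally show ?thesis by (simp add: D_def algebra_simps)
  qed
  have "\<exists>a. a \<in> U \<and> card (nb a) \<le> 4 * D \<and> adj a (fst p) \<and> adj a (snd p)" if "p \<in> Ps" for p
    using that by (auto simp: Ps_def Q_def)
  then obtain a where a: "\<And>p. p \<in> Ps \<Longrightarrow> a p \<in> U \<and> card (nb (a p)) \<le> 4 * D \<and> adj (a p) (fst p) \<and> adj (a p) (snd p)"
    by metis
  \<comment> \<open>\<open>a p\<close> itself is avoided as well, since a subdivision vertex must
    stay outside \<open>B\<close>.\<close>
  define bad where "bad = (\<lambda>p. (insert (a p) (nb (a p) - {fst p, snd p}) \<union> bk (fst p) \<union> bk (snd p)) \<inter> W)"
  \<comment> \<open>\<open>bad p\<close> has at most \<open>(4 * D + 1) + 2 * D \<le> 7 * D\<close>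
    elements; \<open>q\<close> is twice this, as \<open>count_sparse_samples\<close>
    demands.\<close>
  define q where "q = 14 * D"
  have q0: "0 < q" using D0 by (simp add: q_def)
  have badc: "2 * card (bad p) \<le> q" if "p \<in> Ps" for p
  proof -
    have "bk (fst p) \<subseteq> U" "fst p \<in> U" "snd p \<in> U" using that W(1) by (auto simp: Ps_def bk_def)
    then have b: "card (bk (fst p)) \<le> D" "card (bk (snd p)) \<le> D" using bkd by (auto simp: bk_def D_def)
    have "card (bad p) \<le> card (insert (a p) (nb (a p)) \<union> bk (fst p) \<union> bk (snd p))"
      using fbk by (intro card_mono) (auto simp: bad_def)
    also have "\<dots> \<le> card (insert (a p) (nb (a p))) + card (bk (fst p)) + card (bk (snd p))"
      by (meson add_le_mono1 card_Un_le le_trans)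
    also have "card (insert (a p) (nb (a p))) \<le> Suc (card (nb (a p)))" by (rule card_insert_le_m1) auto
    finally show ?thesis using b a[OF that] D0 by (simp add: q_def)
  qed
  have bads: "bad p \<subseteq> W - {fst p, snd p}" if "p \<in> Ps" for p
    using that a[OF that] irr sym by (auto simp: bad_def bk_def Ps_def)
  define F where "F = W \<rightarrow>\<^sub>E {..<q}"
  have fF: "finite F" unfolding F_def using fW by (intro finite_PiE) auto
  define good where "good = (\<lambda>f :: 'a \<Rightarrow> nat. {p \<in> Ps. f (fst p) = 0 \<and> f (snd p) = 0 \<and> (\<forall>z\<in>bad p. f z \<noteq> 0)})"
  \<comment> \<open>On average there are at least \<open>card Ps / (2 * q ^ 2)\<close> good pairs
    and exactly \<open>card W / q\<close> sampled vertices. As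
    \<open>4 * N * q = 56 * N * D\<close>, the size of \<open>Ps\<close> gives the ratio
    \<open>2 * N\<close>; the 2 is lost when ordered pairs become edges.\<close>
  have "\<exists>f\<in>F. 2 * N * card {x \<in> W. f x = 0} < card (good f)"
  proof (rule ccontr)
    assume "\<not> ?thesis"
    then have no: "card (good f) \<le> 2 * N * card {x \<in> W. f x = 0}" if "f \<in> F" for f using that by (meson not_less)
    have "card Ps * q ^ card W \<le> (\<Sum>p\<in>Ps. 2 * q ^ 2 * card {f \<in> F. f (fst p) = 0 \<and> f (snd p) = 0 \<and> (\<forall>z\<in>bad p. f z \<noteq> 0)})"
    proof -
      have "q ^ card W \<le> 2 * q ^ 2 * card {f \<in> F. f (fst p) = 0 \<and> f (snd p) = 0 \<and> (\<forall>z\<in>bad p. f z \<noteq> 0)}" if p: "p \<in> Ps" for p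
        unfolding F_def
        by (rule count_sparse_samples[OF fW(1) _ _ _ bads[OF p] badc[OF p] q0]) (use p in \<open>auto simp: Ps_def Q_def\<close>)
      then show ?thesis using sum_bounded_below[of Ps "q ^ card W"] by simp
    qed
    also have "\<dots> = 2 * q ^ 2 * (\<Sum>f\<in>F. card (good f))"
      unfolding sum_distrib_left[symmetric] good_def
      using sum_multicount_gen[OF fF fP, of "\<lambda>f p. f (fst p) = 0 \<and> f (snd p) = 0 \<and> (\<forall>z\<in>bad p. f z \<noteq> 0)"
          "\<lambda>p. card {f \<in> F. f (fst p) = 0 \<and> f (snd p) = 0 \<and> (\<forall>z\<in>bad p. f z \<noteq> 0)}"] by simp
    also have "\<dots> \<le> 2 * q ^ 2 * (\<Sum>f\<in>F. 2 * N * card {x \<in> W. f x = 0})"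
      using no by (intro mult_le_mono2 sum_mono)
    also have "\<dots> = 4 * N * q * (q * (\<Sum>f\<in>F. card {x \<in> W. f x = 0}))"
      by (simp add: sum_distrib_left[symmetric] power2_eq_square)
    also have "(\<Sum>f\<in>F. card {x \<in> W. f x = 0}) = (\<Sum>x\<in>W. card {f \<in> F. f x = 0})"
      using sum_multicount_gen[OF fF fW(1), of "\<lambda>f x. f x = 0" "\<lambda>x. card {f \<in> F. f x = 0}"] by simp
    also have "q * (\<Sum>x\<in>W. card {f \<in> F. f x = 0}) = (\<Sum>x\<in>W. q ^ card W)"
      unfolding sum_distrib_left F_def using count_single_samples[OF fW(1) _ q0] by (intro sum.cong) auto
    finally have "q ^ card W * card Ps \<le> q ^ card W * (4 * N * q * card W)" by (simp add: mult_ac)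
    then have "card Ps \<le> 4 * N * q * card W" using q0 by simp
    also have "\<dots> = 56 * N * Suc k * (m * card W)" by (simp add: q_def D_def algebra_simps)
    also have "\<dots> < (56 * N * Suc k + 1) * (m * card W)" using m0 fW by (intro mult_strict_right_mono) auto
    also have "\<dots> \<le> card Ps" using cP by (simp only: mult.assoc)
    finally show False by simp
  qed
  then obtain f where f: "f \<in> F" "2 * N * card {x \<in> W. f x = 0} < card (good f)" by auto
  \<comment> \<open>Sampled vertices with a sampled earlier neighbour are deleted, which makes
    \<open>B\<close> independent; \<open>bad\<close> was chosen so that the ends of good pairs are
    not deleted.\<close>
  define B where "B = {x \<in> W. f x = 0 \<and> (\<forall>u\<in>bk x \<inter> W. f u \<noteq> 0)}"
  define E where "E = (\<lambda>p. {fst p, snd p}) ` good f"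
  have gB: "fst p \<in> B" "snd p \<in> B" "fst p \<noteq> snd p" if "p \<in> good f" for p
    using that by (auto simp: good_def B_def bad_def Ps_def Q_def)
  have fg: "finite (good f)" using fP by (simp add: good_def)
  have "card (good f) \<le> card E * 2"
  proof (rule card_le_mult_fibre[OF fg, of E "\<lambda>p. {fst p, snd p}"])
    fix p assume "p \<in> good f"
    have "{p' \<in> good f. {fst p', snd p'} = {fst p, snd p}} \<subseteq> {p, (snd p, fst p)}"
      by (auto simp: doubleton_eq_iff prod_eq_iff)
    then have "card {p' \<in> good f. {fst p', snd p'} = {fst p, snd p}} \<le> card {p, (snd p, fst p)}"
      by (intro card_mono) auto
    also have "\<dots> \<le> 2" by (simp add: card_insert_if)
    finally show "card {p' \<in> good f. {fst p', snd p'} = {fst p, snd p}} \<le> 2" .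
  qed (use fg in \<open>auto simp: E_def\<close>)
  moreover have "card B \<le> card {x \<in> W. f x = 0}" using fW by (intro card_mono) (auto simp: B_def)
  ultimately have cE: "N * card B \<le> card E"
    using f(2) mult_le_mono2[of "card B" "card {x \<in> W. f x = 0}" N] by linarith
  have "good f \<noteq> {}" using f(2) by auto
  then have B0: "B \<noteq> {}" using gB by auto
  have ind: "\<not> adj x y" if "x \<in> B" "y \<in> B" for x y
  proof
    assume xy: "adj x y"
    then have "x \<noteq> y" using irr by auto
    then have "r x \<noteq> r y" using that W(1) inj unfolding B_def by (auto dest: inj_onD)
    then consider "r y < r x" | "r x < r y" by linarith
    then show False
    proof cases
      case 1
      then have "y \<in> bk x \<inter> W" using xy that W(1) by (auto simp: bk_def B_def)
      then show False using that unfolding B_def by blast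
    next
      case 2
      then have "x \<in> bk y \<inter> W" using sym[OF xy] that W(1) by (auto simp: bk_def B_def)
      then show False using that unfolding B_def by blast
    qed
  qed
  have "\<exists>v. v \<in> U - B \<and> {u \<in> B. adj v u} = e" if "e \<in> E" for e
  proof -
    obtain p where p: "p \<in> good f" "e = {fst p, snd p}" using \<open>e \<in> E\<close> unfolding E_def by blast
    then have pP: "p \<in> Ps" and pb: "\<And>z. z \<in> bad p \<Longrightarrow> f z \<noteq> 0" by (auto simp: good_def)
    have "a p \<notin> B"
    proof
      assume "a p \<in> B"
      then have "a p \<in> bad p" "f (a p) = 0" by (auto simp: bad_def B_def)
      then show False using pb by auto
    qed
    moreover have "u \<in> e" if "u \<in> B" "adj (a p) u" for u
    proof (rule ccontr)
      assume "u \<notin> e"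
      then have "u \<in> bad p" "f u = 0" using that p W(1) by (auto simp: bad_def nb_def B_def)
      then show False using pb by auto
    qed
    ultimately show ?thesis using a[OF pP] gB[OF p(1)] p(2) by (intro exI[of _ "a p"]) auto
  qed
  then obtain w where w: "\<And>e. e \<in> E \<Longrightarrow> w e \<in> U - B \<and> {u \<in> B. adj (w e) u} = e" by metis
  have "e \<subseteq> B \<and> card e = 2" if "e \<in> E" for e using that gB by (auto simp: E_def)
  then show ?thesis using cE B0 ind w W(1)
    by (intro exI[of _ B] exI[of _ E] exI[of _ w]) (auto simp: B_def)
qed

text \<open>One bit per vertex recovers which arcs to drop.\<close>

lemma patterns_bipartite:
  assumes "finite V"
  shows "card (patterns (\<lambda>u v. adj u v \<and> (u \<in> B) \<noteq> (v \<in> B)) V m) \<le> card (patterns adj V m) * 2 ^ m"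
proof -
  let ?adj = "\<lambda>u v. adj u v \<and> (u \<in> B) \<noteq> (v \<in> B)"
  let ?g = "\<lambda>(h, S). {(i, j) \<in> h. (i \<in> S) \<noteq> (j \<in> S)}"
  have "patterns ?adj V m \<subseteq> ?g ` (patterns adj V m \<times> Pow {..<m})"
  proof
    fix h assume "h \<in> patterns ?adj V m"
    then obtain xs where xs: "set xs \<subseteq> V" "distinct xs" "length xs = m" "h = pattern ?adj xs"
      by (auto simp: patterns_def)
    have "h = ?g (pattern adj xs, {i. i < m \<and> xs ! i \<in> B})" using xs by (auto simp: pattern_def)
    moreover have "pattern adj xs \<in> patterns adj V m" using xs by (auto simp: patterns_def)
    ultimately show "h \<in> ?g ` (patterns adj V m \<times> Pow {..<m})"
      by (intro image_eqI[of _ _ "(pattern adj xs, {i. i < m \<and> xs ! i \<in> B})"]) auto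
  qed
  then have "card (patterns ?adj V m) \<le> card (patterns adj V m \<times> Pow {..<m})"
    using finite_patterns[OF assms, of adj m]
    by (meson card_image_le card_mono finite_Pow_iff finite_SigmaI finite_imageI finite_lessThan le_trans)
  then show ?thesis by (simp add: card_cartesian_product card_Pow)
qed

lemma patterns_mono: "U \<subseteq> V \<Longrightarrow> patterns adj U m \<subseteq> patterns adj V m"
  by (auto simp: patterns_def)

text \<open>A smallest set \<open>X\<close> of large minimum degree becomes degenerate when one
  vertex is removed. It thus has large minimum degree and few earlier neighbours at once, as the
  sampling requires, and the resulting 1-subdivision is too dense for
  \<open>no_dense_subdivision\<close>.\<close>

theorem bounded_degeneracy:
  fixes adj :: "'a \<Rightarrow> 'a \<Rightarrow> bool"
  assumes fin: "finite V" and sym: "\<And>u v. adj u v \<Longrightarrow> adj v u" and irr: "\<And>v. \<not> adj v v"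
    and c: "1 \<le> c" and small: "\<And>m. card (patterns adj V m) \<le> fact m * c ^ m"
    and sparse: "\<And>S T. S \<subseteq> V \<Longrightarrow> T \<subseteq> V \<Longrightarrow> card S = Suc k \<Longrightarrow> card T = Suc k \<Longrightarrow> \<exists>x\<in>S. \<exists>y\<in>T. \<not> adj x y"
    and m: "2 * Suc k * (56 * dense_bound (2 * c) 1 * Suc k + 2 * Suc k + 1) ^ k < m"
    and U: "U \<subseteq> V" "U \<noteq> {}"
  shows "\<exists>v\<in>U. card {u \<in> U. adj v u} < Suc k * m"
proof (rule ccontr)
  assume "\<not> ?thesis"
  then have ex: "U \<subseteq> V \<and> U \<noteq> {} \<and> (\<forall>v\<in>U. Suc k * m \<le> card {u \<in> U. adj v u})" using U by (meson not_less)
  obtain X where X: "X \<subseteq> V" "X \<noteq> {}" "\<And>v. v \<in> X \<Longrightarrow> Suc k * m \<le> card {u \<in> X. adj v u}"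
    and min: "\<And>Y. Y \<subseteq> V \<and> Y \<noteq> {} \<and> (\<forall>v\<in>Y. Suc k * m \<le> card {u \<in> Y. adj v u}) \<Longrightarrow> card X \<le> card Y"
    using ex_has_least_nat[of "\<lambda>Y. Y \<subseteq> V \<and> Y \<noteq> {} \<and> (\<forall>v\<in>Y. Suc k * m \<le> card {u \<in> Y. adj v u})" U card, OF ex]
    by auto
  have fX: "finite X" using X fin finite_subset by blast
  obtain x where x: "x \<in> X" using X by auto
  have "\<exists>v\<in>W. card {u \<in> W. adj v u} \<le> Suc k * m - 1" if W: "W \<subseteq> X - {x}" "W \<noteq> {}" for W
  proof -
    have "card W < card X" using W x fX by (intro psubset_card_mono) auto
    then obtain v where "v \<in> W" "card {u \<in> W. adj v u} < Suc k * m"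
      using min[of W] W X(1) by (meson Diff_subset not_less subset_trans)
    then show ?thesis by (intro bexI[of _ v]) auto
  qed
  from degeneracy_order[OF finite_Diff[OF fX, of "{x}"] this] obtain s :: "'a \<Rightarrow> nat" where s: "inj_on s (X - {x})"
    "\<And>v. v \<in> X - {x} \<Longrightarrow> card {u \<in> X - {x}. adj v u \<and> s u < s v} \<le> Suc k * m - 1" by blast
  \<comment> \<open>\<open>x\<close> is ranked first and adds at most one earlier neighbour to each
    other vertex; this is why the order on the rest has the bound
    \<open>Suc k * m - 1\<close>.\<close>
  define r where "r = (\<lambda>v. if v = x then 0 else Suc (s v))"
  have inj: "inj_on r X" using s(1) by (auto simp: r_def inj_on_def)
  have m0: "1 \<le> Suc k * m" using m by (cases m) auto
  have bkd: "card {u \<in> X. adj v u \<and> r u < r v} \<le> Suc k * m" if v: "v \<in> X" for v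
  proof (cases "v = x")
    case False
    have "{u \<in> X. adj v u \<and> r u < r v} \<subseteq> insert x {u \<in> X - {x}. adj v u \<and> s u < s v}"
      using False by (auto simp: r_def)
    then have "card {u \<in> X. adj v u \<and> r u < r v} \<le> card (insert x {u \<in> X - {x}. adj v u \<and> s u < s v})"
      using fX by (intro card_mono) auto
    also have "\<dots> \<le> Suc (card {u \<in> X - {x}. adj v u \<and> s u < s v})" using fX by (simp add: card_insert_if)
    also have "\<dots> \<le> Suc k * m" using s(2)[of v] v False m0 by auto
    finally show ?thesis .
  qed (simp add: r_def)
  have sp: "\<exists>x\<in>S. \<exists>y\<in>T. \<not> adj x y" if "S \<subseteq> X" "T \<subseteq> X" "card S = Suc k" "card T = Suc k" for S T
    using sparse[of S T] that X(1) by auto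
  have "\<exists>B E w. B \<subseteq> X \<and> B \<noteq> {} \<and> dense_bound (2 * c) 1 * card B \<le> card E \<and> (\<forall>x\<in>B. \<forall>y\<in>B. \<not> adj x y) \<and>
      (\<forall>e\<in>E. e \<subseteq> B \<and> card e = 2 \<and> w e \<in> X - B \<and> {u \<in> B. adj (w e) u} = e)"
    by (rule exists_dense_1_subdivision[OF fX X(2) sym irr sp X(3) inj bkd m])
  then obtain B E w where BEw: "B \<subseteq> X \<and> B \<noteq> {} \<and> dense_bound (2 * c) 1 * card B \<le> card E \<and>
      (\<forall>x\<in>B. \<forall>y\<in>B. \<not> adj x y) \<and> (\<forall>e\<in>E. e \<subseteq> B \<and> card e = 2 \<and> w e \<in> X - B \<and> {u \<in> B. adj (w e) u} = e)"
    by (elim exE)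
  then have B: "B \<subseteq> X" "B \<noteq> {}" "dense_bound (2 * c) 1 * card B \<le> card E" "\<forall>x\<in>B. \<forall>y\<in>B. \<not> adj x y"
    "\<And>e. e \<in> E \<Longrightarrow> e \<subseteq> B \<and> card e = 2 \<and> w e \<in> X - B \<and> {u \<in> B. adj (w e) u} = e" by simp_all
  \<comment> \<open>Keeping only the edges across \<open>B\<close> removes those between subdivision
    vertices; the price is the constant \<open>2 * c\<close> in place of \<open>c\<close>.\<close>
  let ?adj = "\<lambda>u v. adj u v \<and> (u \<in> B) \<noteq> (v \<in> B)"
  interpret induced_subdivision ?adj X 1 B E "\<lambda>e. [w e]"
  proof
    fix e assume e: "e \<in> E"
    have we: "w e \<in> X" "w e \<notin> B" "{u \<in> B. adj (w e) u} = e" using B(5)[OF e] by auto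
    obtain y z where yz: "e = {y, z}" "y \<noteq> z" using B(5)[OF e] by (meson card_2_iff)
    have "y \<in> B" "z \<in> B" "adj (w e) y" "adj (w e) z" using we yz by auto
    then show "\<exists>x y. e = {x, y} \<and> successively ?adj (x # [w e] @ [y])"
      using yz we sym by (intro exI[of _ y] exI[of _ z]) auto
    show "e \<subseteq> B \<and> card e = 2" "set [w e] \<subseteq> X - B" using B(5)[OF e] by auto
    fix v x assume "v \<in> set [w e]" "x \<in> B" "?adj v x"
    then show "x \<in> e" using we by auto
  next
    fix e f assume e: "e \<in> E" "f \<in> E" "e \<noteq> f"
    have "{u \<in> B. adj (w e) u} \<noteq> {u \<in> B. adj (w f) u}" using B(5)[OF e(1)] B(5)[OF e(2)] e(3) by metis
    then show "set [w e] \<inter> set [w f] = {}" by auto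
  next
    fix e f u v assume "e \<in> E" "f \<in> E" "u \<in> set [w e]" "v \<in> set [w f]"
    then show "\<not> ?adj u v" using B(5)[of e] B(5)[of f] by auto
  qed (use fX B(1) B(4) sym in auto)
  have "card (patterns ?adj X m) \<le> fact m * (2 * c) ^ m" for m
  proof -
    have "card (patterns ?adj X m) \<le> card (patterns adj X m) * 2 ^ m" by (rule patterns_bipartite[OF fX])
    also have "\<dots> \<le> (fact m * c ^ m) * 2 ^ m"
      using card_mono[OF finite_patterns[OF fin] patterns_mono[OF X(1)], of adj m] small[of m]
      by (intro mult_le_mono1) linarith
    finally show ?thesis by (simp add: power_mult_distrib mult_ac)
  qed
  from no_dense_subdivision[OF induced_subdivision_axioms B(2) _ this] show False using B(3) c by simp
qed

section \<open>Labels from a degeneracy order\<close>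

definition bits :: "nat \<Rightarrow> nat \<Rightarrow> bool list" where
  "bits w n = map (bit n) [0..<w]"

lemma length_bits [simp]: "length (bits w n) = w" by (simp add: bits_def)

lemma bits_inject: "a < 2 ^ w \<Longrightarrow> b < 2 ^ w \<Longrightarrow> bits w a = bits w b \<longleftrightarrow> a = b"
  unfolding bits_def by (metis horner_sum_bit_eq_take_bit take_bit_nat_eq_self)

lemma length_concat_bits: "length (concat (map (bits w) xs)) = length xs * w"
  by (induction xs) auto

lemma nth_block_concat_bits:
  "i < length xs \<Longrightarrow> take w (drop (i * w) (concat (map (bits w) xs))) = bits w (xs ! i)"
proof (induction xs arbitrary: i)
  case (Cons x xs)
  then show ?case by (cases i) auto
qed simp

text \<open>Block 0 of a label holds the number of the vertex, blocks \<open>1..d\<close> those of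
  its earlier neighbours. The decoder knows \<open>d\<close> but not \<open>n\<close>, so the block
  width is recovered from the label length.\<close>

definition adj_decoder :: "nat \<Rightarrow> bool list \<Rightarrow> bool list \<Rightarrow> bool" where
  "adj_decoder d L M \<longleftrightarrow> (let w = length L div Suc d in
     (\<exists>i\<in>{1..d}. take w (drop (i * w) L) = take w M \<or> take w (drop (i * w) M) = take w L))"

lemma adj_decoder_concat_bits:
  assumes "length xs = d" "length ys = d" "\<forall>a\<in>set (x # xs) \<union> set (y # ys). a < 2 ^ w"
  shows "adj_decoder d (concat (map (bits w) (x # xs))) (concat (map (bits w) (y # ys)))
    \<longleftrightarrow> y \<in> set xs \<or> x \<in> set ys"
proof -
  let ?L = "\<lambda>zs. concat (map (bits w) zs)"
  have w: "length (?L (x # xs)) div Suc d = w" unfolding length_concat_bits using assms(1) by (simp del: mult_Suc)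
  have blk: "take w (drop (i * w) (?L (z # zs))) = bits w (zs ! (i - 1))"
    if "i \<in> {1..d}" "length zs = d" for i z and zs :: "nat list"
    using nth_block_concat_bits[of i "z # zs" w] that by (cases i) auto
  have hd: "take w (?L (z # zs)) = bits w z" for z and zs :: "nat list" by simp
  have mem: "(\<exists>i\<in>{1..d}. bits w (zs ! (i - 1)) = bits w z) \<longleftrightarrow> z \<in> set zs"
    if "length zs = d" "\<forall>a\<in>set zs. a < 2 ^ w" "z < 2 ^ w" for z and zs :: "nat list"
  proof
    assume "\<exists>i\<in>{1..d}. bits w (zs ! (i - 1)) = bits w z"
    then obtain i where i: "i \<in> {1..d}" "bits w (zs ! (i - 1)) = bits w z" by auto
    then have "zs ! (i - 1) \<in> set zs" using that by (intro nth_mem) auto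
    then show "z \<in> set zs" using i(2) bits_inject that by metis
  next
    assume "z \<in> set zs"
    then obtain j where "j < length zs" "zs ! j = z" unfolding in_set_conv_nth by blast
    then have "j < d" "zs ! j = z" using that by simp_all
    then show "\<exists>i\<in>{1..d}. bits w (zs ! (i - 1)) = bits w z" by (intro bexI[of _ "Suc j"]) auto
  qed
  have "adj_decoder d (?L (x # xs)) (?L (y # ys)) \<longleftrightarrow>
      (\<exists>i\<in>{1..d}. bits w (xs ! (i - 1)) = bits w y \<or> bits w (ys ! (i - 1)) = bits w x)"
    unfolding adj_decoder_def w Let_def using blk[OF _ assms(1)] blk[OF _ assms(2)] hd by simp
  also have "\<dots> \<longleftrightarrow> y \<in> set xs \<or> x \<in> set ys"
    using mem[of xs y] mem[of ys x] assms by auto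
  finally show ?thesis .
qed

text \<open>The lists are padded with \<open>v\<close> itself, which is harmless as only distinct vertices are compared.\<close>

lemma back_neighbour_lists:
  fixes adj :: "'a \<Rightarrow> 'a \<Rightarrow> bool" and r :: "'a \<Rightarrow> nat"
  assumes fin: "finite U" and sym: "\<And>u v. adj u v \<Longrightarrow> adj v u" and inj: "inj_on r U"
    and bkd: "\<And>v. v \<in> U \<Longrightarrow> card {u \<in> U. adj v u \<and> r u < r v} \<le> d"
  shows "\<exists>f. \<forall>v\<in>U. length (f v) = d \<and> set (f v) \<subseteq> U \<and>
    (\<forall>u\<in>U. u \<noteq> v \<longrightarrow> (adj u v \<longleftrightarrow> v \<in> set (f u) \<or> u \<in> set (f v)))"
proof -
  have "\<exists>xs. length xs = d \<and> set xs \<subseteq> U \<and> set xs - {v} = {u \<in> U. adj v u \<and> r u < r v}" if v: "v \<in> U" for v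
  proof -
    have "finite {u \<in> U. adj v u \<and> r u < r v}" using fin by simp
    then obtain ys where ys: "set ys = {u \<in> U. adj v u \<and> r u < r v}" "distinct ys"
      using finite_distinct_list by blast
    have "length ys \<le> d" using bkd[OF v] ys distinct_card by metis
    define zs where "zs = ys @ replicate (d - length ys) v"
    have "length zs = d" using \<open>length ys \<le> d\<close> by (simp add: zs_def)
    moreover have "set ys \<subseteq> set zs" "set zs \<subseteq> insert v (set ys)" by (auto simp: zs_def)
    moreover have "v \<notin> set ys" "set ys \<subseteq> U" using ys(1) by auto
    ultimately show ?thesis using ys(1) v by (intro exI[of _ zs]) blast
  qed
  then obtain f where f: "\<And>v. v \<in> U \<Longrightarrow> length (f v) = d \<and> set (f v) \<subseteq> U \<and>
      set (f v) - {v} = {u \<in> U. adj v u \<and> r u < r v}"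
    by metis
  have "adj u v \<longleftrightarrow> v \<in> set (f u) \<or> u \<in> set (f v)" if uv: "v \<in> U" "u \<in> U" "u \<noteq> v" for u v
  proof -
    have "v \<in> set (f u) \<longleftrightarrow> adj u v \<and> r v < r u" using f[OF uv(2)] uv by blast
    moreover have "u \<in> set (f v) \<longleftrightarrow> adj v u \<and> r u < r v" using f[OF uv(1)] uv by blast
    moreover have "r u \<noteq> r v" using uv inj by (auto dest: inj_onD)
    ultimately show ?thesis using sym by (metis linorder_neqE_nat)
  qed
  then show ?thesis using f by (intro exI[of _ f]) blast
qed

text \<open>Vertex numbers run up to \<open>n\<close> inclusive, hence \<open>n + 1\<close> under
  the logarithm.\<close>

definition width :: "nat \<Rightarrow> nat" where
  "width n = nat \<lceil>log 2 (real n + 1)\<rceil>"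

lemma less_power_width: "n < 2 ^ width n"
proof -
  have "log 2 (real n + 1) \<le> real (width n)" by (simp add: width_def)
  then have "real n + 1 \<le> 2 powr real (width n)" by (simp add: log_le_iff)
  moreover have "real (2 ^ width n) = 2 powr real (width n)" by (simp add: powr_realpow)
  ultimately have "real n < real (2 ^ width n)" by linarith
  then show ?thesis by (simp only: of_nat_less_iff)
qed

text \<open>For \<open>2 \<le> n\<close>, \<open>n + 1 \<le> n ^ 2\<close> gives
  \<open>2 * log 2 n\<close>, and rounding up adds at most 1, itself at most \<open>log 2 n\<close>;
  hence the factor 3.\<close>

lemma width_bigo: "(\<lambda>n. real (d * width n)) \<in> O(\<lambda>n. log 2 (real n))"
proof (rule bigoI[of _ "3 * real d"])
  have "norm (real (d * width n)) \<le> 3 * real d * norm (log 2 (real n))" if n: "2 \<le> n" for n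
  proof -
    have "0 \<le> log 2 (real n + 1)" by simp
    then have "real (width n) \<le> log 2 (real n + 1) + 1"
      unfolding width_def by linarith
    also have "log 2 (real n + 1) \<le> log 2 (real n ^ 2)"
    proof -
      have "2 * real n \<le> real n ^ 2" using n by (simp add: power2_eq_square)
      then have "real n + 1 \<le> real n ^ 2" using n by linarith
      then show ?thesis using n by simp
    qed
    also have "log 2 (real n ^ 2) = 2 * log 2 (real n)" using n by (simp add: log_nat_power)
    also have "1 \<le> log 2 (real n)" using n by (simp add: le_log_iff)
    finally have w: "real (width n) \<le> 3 * log 2 (real n)" by simp
    have "0 \<le> log 2 (real n)" using n by simp
    then show ?thesis using mult_left_mono[OF w, of "real d"] by simp
  qed
  then show "\<forall>\<^sub>F n in sequentially. norm (real (d * width n)) \<le> 3 * real d * norm (log 2 (real n))"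
    unfolding eventually_sequentially by blast
qed

lemma degenerate_labeling_scheme:
  assumes G: "\<And>G. G \<in> \<X> \<Longrightarrow> pair_graph G"
    and deg: "\<And>G U. G \<in> \<X> \<Longrightarrow> U \<subseteq> pverts G \<Longrightarrow> U \<noteq> {} \<Longrightarrow> \<exists>v\<in>U. card {u \<in> U. (v, u) \<in> parcs G} \<le> d"
  shows "\<exists>enc. adjacency_labeling_scheme \<X> (\<lambda>n. Suc d * width n) enc (adj_decoder d)"
proof -
  have "\<exists>f. \<forall>v\<in>pverts G. length (f v) = d \<and> set (f v) \<subseteq> pverts G \<and>
    (\<forall>u\<in>pverts G. u \<noteq> v \<longrightarrow> ((u, v) \<in> parcs G \<longleftrightarrow> v \<in> set (f u) \<or> u \<in> set (f v)))" if GX: "G \<in> \<X>" for G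
  proof -
    interpret pair_graph G by (rule G[OF GX])
    obtain r :: "nat \<Rightarrow> nat" where r: "inj_on r (pverts G)"
      "\<And>v. v \<in> pverts G \<Longrightarrow> card {u \<in> pverts G. (v, u) \<in> parcs G \<and> r u < r v} \<le> d"
      using degeneracy_order[of "pverts G" "\<lambda>u v. (u, v) \<in> parcs G" d] deg[OF GX] by auto
    show ?thesis
      by (rule back_neighbour_lists[of "pverts G" "\<lambda>u v. (u, v) \<in> parcs G" r d])
        (use r arcs_symmetric in auto)
  qed
  then obtain f where f: "\<And>G v. G \<in> \<X> \<Longrightarrow> v \<in> pverts G \<Longrightarrow> length (f G v) = d \<and> set (f G v) \<subseteq> pverts G \<and>
    (\<forall>u\<in>pverts G. u \<noteq> v \<longrightarrow> ((u, v) \<in> parcs G \<longleftrightarrow> v \<in> set (f G u) \<or> u \<in> set (f G v)))"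
    by metis
  define enc where "enc = (\<lambda>G v. concat (map (bits (width (card (pverts G)))) (v # f G v)))"
  have "adjacency_labeling_scheme \<X> (\<lambda>n. Suc d * width n) enc (adj_decoder d)"
    unfolding adjacency_labeling_scheme_def
  proof (intro allI ballI conjI impI)
    fix n G v assume "G \<in> labelled_graphs \<X> n" and v: "v \<in> pverts G"
    then have GX: "G \<in> \<X>" and V: "pverts G = {1..n}" by (auto simp: labelled_graphs_def)
    then show "length (enc G v) = Suc d * width n"
      unfolding enc_def length_concat_bits using f[OF GX v] by simp
    fix u assume u: "u \<in> pverts G" and uv: "u \<noteq> v"
    have "a < 2 ^ width n" if "a \<in> pverts G" for a
      using that V less_power_width[of n] by auto
    then have "\<forall>a\<in>set (u # f G u) \<union> set (v # f G v). a < 2 ^ width n"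
      using f[OF GX u] f[OF GX v] u v by auto
    then have "adj_decoder d (enc G u) (enc G v) \<longleftrightarrow> v \<in> set (f G u) \<or> u \<in> set (f G v)"
      unfolding enc_def V card_atLeastAtMost diff_Suc_1
      using adj_decoder_concat_bits f[OF GX u] f[OF GX v] by auto
    then show "adj_decoder d (enc G u) (enc G v) \<longleftrightarrow> (u, v) \<in> parcs G"
      using f[OF GX v] u uv by blast
  qed
  then show ?thesis by blast
qed

section \<open>Application to graph classes\<close>

lemma induced_mem:
  assumes "graph_class \<X>" "hereditary \<X>" "G \<in> \<X>" "U \<subseteq> pverts G"
  shows "\<lparr>pverts = U, parcs = parcs G \<inter> U \<times> U\<rparr> \<in> \<X>"
proof -
  interpret pair_graph G using assms by (auto simp: graph_class_def)
  have "wf_digraph (with_proj \<lparr>pverts = U, parcs = parcs G \<inter> U \<times> U\<rparr>)"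
    by unfold_locales auto
  then have "induced_subgraph (with_proj \<lparr>pverts = U, parcs = parcs G \<inter> U \<times> U\<rparr>) (with_proj G)"
    unfolding induced_subgraph_def subgraph_def compatible_def
    using assms(4) wf_digraph_axioms by auto
  then show ?thesis using assms unfolding hereditary_def by blast
qed

lemma relabel_mem:
  assumes "graph_class \<X>" "G \<in> \<X>" "inj_on g (pverts G)"
  shows "\<lparr>pverts = g ` pverts G, parcs = map_prod g g ` parcs G\<rparr> \<in> \<X>"
proof -
  interpret pair_graph G using assms by (auto simp: graph_class_def)
  let ?f = "\<lparr>iso_verts = g, iso_arcs = map_prod g g, iso_head = snd, iso_tail = fst\<rparr>"
  have sub: "parcs G \<subseteq> pverts G \<times> pverts G" using in_arcsD1 in_arcsD2 by auto
  have "inj_on (map_prod g g) (parcs G)"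
    using map_prod_inj_on[OF assms(3) assms(3)] sub inj_on_subset by blast
  then have "pre_digraph.digraph_isomorphism (with_proj G) ?f"
    unfolding pre_digraph.digraph_isomorphism_def using assms(3) wf_digraph_axioms by auto
  moreover have "with_proj \<lparr>pverts = g ` pverts G, parcs = map_prod g g ` parcs G\<rparr> = app_iso ?f (with_proj G)"
    by (simp add: with_proj_def app_iso_def)
  ultimately have "digraph_iso (with_proj G) (with_proj \<lparr>pverts = g ` pverts G, parcs = map_prod g g ` parcs G\<rparr>)"
    unfolding digraph_iso_def by blast
  then show ?thesis using assms unfolding graph_class_def by blast
qed

lemma finite_labelled_graphs:
  assumes "graph_class \<X>"
  shows "finite (labelled_graphs \<X> n)"
proof (rule inj_on_finite[of parcs])
  show "inj_on parcs (labelled_graphs \<X> n)"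
    by (auto simp: inj_on_def labelled_graphs_def intro: pair_pre_digraph.equality)
  show "parcs ` labelled_graphs \<X> n \<subseteq> Pow ({1..n} \<times> {1..n})"
  proof
    fix A assume "A \<in> parcs ` labelled_graphs \<X> n"
    then obtain G where G: "G \<in> \<X>" "pverts G = {1..n}" "A = parcs G" by (auto simp: labelled_graphs_def)
    interpret pair_graph G using assms G by (auto simp: graph_class_def)
    show "A \<in> Pow ({1..n} \<times> {1..n})" using in_arcsD1 in_arcsD2 G by auto
  qed
qed auto

text \<open>This carries smallness over to the induced subgraphs of one host: each pattern is an
  induced subgraph renumbered, hence in the class, and \<open>Suc\<close> shifts its vertex set from
  \<open>{..<m}\<close> to \<open>{1..m}\<close>.\<close>

lemma card_patterns_le:
  assumes X: "graph_class \<X>" "hereditary \<X>" and G: "G \<in> \<X>"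
  shows "card (patterns (\<lambda>u v. (u, v) \<in> parcs G) (pverts G) m) \<le> card (labelled_graphs \<X> m)"
proof (rule card_inj_on_le[of "\<lambda>h. \<lparr>pverts = {1..m}, parcs = map_prod Suc Suc ` h\<rparr>"])
  let ?adj = "\<lambda>u v. (u, v) \<in> parcs G"
  show "inj_on (\<lambda>h. \<lparr>pverts = {1..m}, parcs = map_prod Suc Suc ` h\<rparr>) (patterns ?adj (pverts G) m)"
    by (rule inj_onI) (simp add: inj_image_eq_iff prod.inj_map)
  show "(\<lambda>h. \<lparr>pverts = {1..m}, parcs = map_prod Suc Suc ` h\<rparr>) ` patterns ?adj (pverts G) m \<subseteq> labelled_graphs \<X> m"
  proof (rule image_subsetI)
    fix h assume "h \<in> patterns ?adj (pverts G) m"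
    then obtain xs where xs: "set xs \<subseteq> pverts G" "distinct xs" "length xs = m" "h = pattern ?adj xs"
      by (auto simp: patterns_def)
    define g where "g = (\<lambda>v. Suc (SOME i. i < m \<and> xs ! i = v))"
    have gn: "g (xs ! i) = Suc i" if "i < m" for i
      unfolding g_def by (rule arg_cong[of _ _ Suc], rule some_equality)
        (use that xs nth_eq_iff_index_eq in auto)
    have inj: "inj_on g (set xs)"
      by (rule inj_onI) (use gn xs(3) in \<open>auto simp: in_set_conv_nth\<close>)
    let ?H = "\<lparr>pverts = set xs, parcs = parcs G \<inter> set xs \<times> set xs\<rparr>"
    have "?H \<in> \<X>" by (rule induced_mem[OF X G xs(1)])
    from relabel_mem[OF X(1) this, of g] inj
    have "\<lparr>pverts = g ` set xs, parcs = map_prod g g ` (parcs G \<inter> set xs \<times> set xs)\<rparr> \<in> \<X>" by simp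
    moreover have "g ` set xs = {1..m}"
    proof -
      have "set xs = (\<lambda>i. xs ! i) ` {0..<m}" using xs(3) by (auto simp: in_set_conv_nth)
      then have "g ` set xs = Suc ` {0..<m}" using gn by (force simp: image_image)
      then show ?thesis by (simp only: image_Suc_atLeastLessThan atLeastLessThanSuc_atLeastAtMost One_nat_def)
    qed
    moreover have "map_prod g g ` (parcs G \<inter> set xs \<times> set xs) = map_prod Suc Suc ` h"
    proof -
      have "parcs G \<inter> set xs \<times> set xs = (\<lambda>(i, j). (xs ! i, xs ! j)) ` h"
      proof
        show "parcs G \<inter> set xs \<times> set xs \<subseteq> (\<lambda>(i, j). (xs ! i, xs ! j)) ` h"
        proof clarify
          fix u v assume uv: "(u, v) \<in> parcs G" "u \<in> set xs" "v \<in> set xs"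
          then obtain i j where "i < length xs" "u = xs ! i" "j < length xs" "v = xs ! j"
            by (metis in_set_conv_nth)
          then show "(u, v) \<in> (\<lambda>(i, j). (xs ! i, xs ! j)) ` h"
            using uv by (intro image_eqI[of _ _ "(i, j)"]) (auto simp: xs(4) pattern_def)
        qed
      qed (auto simp: xs(4) pattern_def)
      moreover have "map_prod g g (xs ! i, xs ! j) = map_prod Suc Suc (i, j)" if "(i, j) \<in> h" for i j
        using that gn xs by (simp add: pattern_def)
      ultimately show ?thesis by (auto simp: image_image intro!: image_cong)
    qed
    ultimately show "\<lparr>pverts = {1..m}, parcs = map_prod Suc Suc ` h\<rparr> \<in> labelled_graphs \<X> m"
      by (simp add: labelled_graphs_def)
  qed
qed (rule finite_labelled_graphs[OF X(1)])

text \<open>If all pairs were adjacent, a vertex common to both sides would carry a loop, so the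
  sides are disjoint and \<open>t\<close> vertices of each give the forbidden subgraph. The size
  \<open>Suc t\<close> matches the form used in \<open>bounded_degeneracy\<close>.\<close>

lemma weakly_sparse_not_complete:
  assumes "pair_graph G"
    and no: "\<not> (\<exists>H :: ngraph. subgraph (with_proj H) (with_proj G) \<and> complete_bipartite_digraph t t (with_proj H))"
    and S: "S \<subseteq> pverts G" "card S = Suc t" and T: "T \<subseteq> pverts G" "card T = Suc t"
  shows "\<exists>x\<in>S. \<exists>y\<in>T. (x, y) \<notin> parcs G"
proof (rule ccontr)
  interpret pair_graph G by fact
  assume "\<not> ?thesis"
  then have all: "(x, y) \<in> parcs G" if "x \<in> S" "y \<in> T" for x y using that by blast
  obtain S' where S': "S' \<subseteq> S" "card S' = t" "finite S'" using obtain_subset_with_card_n[of t S] S by auto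
  obtain T' where T': "T' \<subseteq> T" "card T' = t" "finite T'" using obtain_subset_with_card_n[of t T] T by auto
  have "S' \<inter> T' = {}" using all S' T' pair_no_loops by fastforce
  moreover define H :: ngraph where "H = \<lparr>pverts = S' \<union> T', parcs = S' \<times> T' \<union> T' \<times> S'\<rparr>"
  ultimately have "complete_bipartite_digraph t t (with_proj H)"
    unfolding complete_bipartite_digraph_pair_def using S' T' by auto
  moreover have "subgraph (with_proj H) (with_proj G)"
  proof -
    have "wf_digraph (with_proj H)" by unfold_locales (auto simp: H_def)
    moreover have "parcs H \<subseteq> parcs G"
    proof -
      have "(x, y) \<in> parcs G \<and> (y, x) \<in> parcs G" if "x \<in> S'" "y \<in> T'" for x y
        using all[of x y] that S' T' arcs_symmetric by blast
      then show ?thesis by (auto simp: H_def)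
    qed
    moreover have "pverts H \<subseteq> pverts G" using S S' T T' by (auto simp: H_def)
    ultimately show ?thesis unfolding subgraph_def compatible_def using wf_digraph_axioms by simp
  qed
  ultimately show False using no by blast
qed

theorem theorem1p2:
  fixes \<X> :: "nat pair_pre_digraph set"
  assumes "graph_class \<X>" and "hereditary \<X>" and "small \<X>" and "weakly_sparse \<X>"
  shows "\<exists>b enc dec. (\<lambda>n. real (b n)) \<in> O(\<lambda>n. log 2 (real n)) \<and>
           adjacency_labeling_scheme \<X> b enc dec"
proof -
  obtain c0 :: real where c0: "\<And>n. real (card (labelled_graphs \<X> n)) \<le> fact n * c0 ^ n"
    using assms(3) by (auto simp: small_def)
  \<comment> \<open>The given constant is real, possibly negative or fractional; the counting
    arguments need a natural number that is at least 1.\<close>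
  define c where "c = nat \<lceil>\<bar>c0\<bar>\<rceil> + 1"
  have c: "card (labelled_graphs \<X> n) \<le> fact n * c ^ n" for n
  proof -
    have "\<bar>c0\<bar> \<le> real c" unfolding c_def by linarith
    then have "c0 ^ n \<le> real c ^ n" by (metis abs_ge_self abs_ge_zero order.trans power_abs power_mono)
    then have "fact n * c0 ^ n \<le> fact n * real c ^ n" by (intro mult_left_mono) auto
    from order_trans[OF c0 this] have "real (card (labelled_graphs \<X> n)) \<le> real (fact n * c ^ n)" by simp
    then show ?thesis by (simp only: of_nat_le_iff)
  qed
  obtain t where t: "\<And>G. G \<in> \<X> \<Longrightarrow> \<not> (\<exists>H :: ngraph. subgraph (with_proj H) (with_proj G) \<and>
      complete_bipartite_digraph t t (with_proj H))"
    using assms(4) by (auto simp: weakly_sparse_def)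
  define m where "m = Suc (2 * Suc t * (56 * dense_bound (2 * c) 1 * Suc t + 2 * Suc t + 1) ^ t)"
  have pg: "pair_graph G" if "G \<in> \<X>" for G using assms(1) that by (auto simp: graph_class_def)
  have deg: "\<exists>v\<in>U. card {u \<in> U. (v, u) \<in> parcs G} \<le> Suc t * m"
    if G: "G \<in> \<X>" and U: "U \<subseteq> pverts G" "U \<noteq> {}" for G U
  proof -
    interpret pair_graph G by (rule pg[OF G])
    have "\<exists>v\<in>U. card {u \<in> U. (v, u) \<in> parcs G} < Suc t * m"
    proof (rule bounded_degeneracy[of "pverts G" "\<lambda>u v. (u, v) \<in> parcs G" c t m U])
      show "card (patterns (\<lambda>u v. (u, v) \<in> parcs G) (pverts G) k) \<le> fact k * c ^ k" for k
        using card_patterns_le[OF assms(1,2) G, of k] c[of k] by linarith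
      show "\<exists>x\<in>S. \<exists>y\<in>T. (x, y) \<notin> parcs G"
        if "S \<subseteq> pverts G" "T \<subseteq> pverts G" "card S = Suc t" "card T = Suc t" for S T
        by (rule weakly_sparse_not_complete[OF pair_graph_axioms t[OF G]]) (use that in auto)
      show "(v, v) \<notin> parcs G" for v using pair_no_loops by fastforce
    qed (use U arcs_symmetric in \<open>auto simp: c_def m_def\<close>)
    then show ?thesis by (auto intro: less_imp_le)
  qed
  obtain enc where "adjacency_labeling_scheme \<X> (\<lambda>n. Suc (Suc t * m) * width n) enc (adj_decoder (Suc t * m))"
    using degenerate_labeling_scheme[OF pg deg] by blast
  then show ?thesis using width_bigo[of "Suc (Suc t * m)"] by (intro exI conjI)
qed

end
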